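(* Let $(Y,\ast)$ be a $2$-dimensional systolic complex with a basepoint $\ast\in Y^0$. Then the squaring $(X_Y,\ast)$ of $(Y,\ast)$ is quadric, i.e. $X_Y$ is a quadric complex.
   Context: All graphs are simplicial. Metrics are considered only on the $0$-skeleton of a complex, and are induced by the shortest path metric $d$ of the $1$-skeleton. The girth of a graph is the length of a shortest embedded cycle (infinite if there is none). The link of a vertex $v$ in a $2$-dimensional simplicial complex is the graph whose vertices are the neighbours of $v$, two of them being joined by an edge if they span a triangle together with $v$. A $2$-dimensional systolic complex is a simply connected $2$-dimensional simplicial complex in which the girth of the link of every vertex is at least $6$. Squaring: given a $2$-dimensional systolic complex $Y$ with basepoint $\ast\in Y^0$, let $X_Y^1$ be the subgraph of $Y^1$ with vertex set $Y^0$ whose edges are all the edges of $Y^1$ whose endpoints are not equidistant to $\ast$ (distances in $Y^1$). The squaring of $(Y,\ast)$ is the based square complex $(X_Y,\ast)$ obtained from $X_Y^1$ by attaching a unique square ($2$-cell) along its boundary to each embedded $4$-cycle of $X_Y^1$. A square complex is a $2$-dimensional CW complex with simplicial $1$-skeleton in which the attaching maps of $2$-cells are injective combinatorial maps from $4$-cycles; the closed $2$-cells are called squares, and no two squares are glued to the same $4$-cycle. A quadric complex is a simply connected square complex satisfying the following two replacement rules. (A) If $u_0,u_1,v_0,v_1,v_2$ are distinct vertices such that the $4$-cycles $(u_0,v_0,u_1,v_1)$ and $(u_0,v_1,u_1,v_2)$ bound squares, then the $4$-cycle $(u_0,v_0,u_1,v_2)$ bounds a square. (B) If $u,a_0,a_1,a_2,b_0,b_1,b_2$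 are distinct vertices such that the three $4$-cycles $(u,a_0,b_0,a_1)$, $(u,a_1,b_1,a_2)$, $(u,a_2,b_2,a_0)$ bound squares, then in the $6$-cycle $(a_0,b_0,a_1,b_1,a_2,b_2)$ some pair of antipodal vertices (one of the pairs $\{b_2,a_1\}$, $\{a_0,b_1\}$, $\{a_2,b_0\}$) is joined by an edge such that both of the $4$-cycles into which this edge divides the $6$-cycle bound squares. *)

theory Defs
  imports "HOL-Analysis.Analysis"
begin

section \<open>Graphs\<close>

record 'v graph =
  verts :: "'v set"
  edges :: "'v set set"

definition simplicial_graph :: "('v, 'm) graph_scheme \<Rightarrow> bool" where
  "simplicial_graph G \<longleftrightarrow> (\<forall>e\<in>edges G. e \<subseteq> verts G \<and> card e = 2)"

definition walk :: "('v, 'm) graph_scheme \<Rightarrow> 'v list \<Rightarrow> bool" where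
  "walk G p \<longleftrightarrow>
     p \<noteq> [] \<and> set p \<subseteq> verts G \<and> successively (\<lambda>x y. {x, y} \<in> edges G) p"

definition graph_dist :: "('v, 'm) graph_scheme \<Rightarrow> 'v \<Rightarrow> 'v \<Rightarrow> enat" where
  "graph_dist G x y = (INF p \<in> {p. walk G p \<and> hd p = x \<and> last p = y}. enat (length p - 1))"

definition cycle_edges :: "'v list \<Rightarrow> 'v set set" where
  "cycle_edges c = {{c ! i, c ! (Suc i mod length c)} | i. i < length c}"

definition embedded_cycle :: "('v, 'm) graph_scheme \<Rightarrow> 'v list \<Rightarrow> bool" where
  "embedded_cycle G c \<longleftrightarrow>
     length c \<ge> 3 \<and> distinct c \<and> set c \<subseteq> verts G \<and> cycle_edges c \<subseteq> edges G"

text \<open>In \<^typ>\<open>enat\<close> the infimum of the empty set is \<open>\<infinity>\<close>, so forests have infinite girth.\<close>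

definition girth :: "('v, 'm) graph_scheme \<Rightarrow> enat" where
  "girth G = (INF c \<in> {c. embedded_cycle G c}. enat (length c))"

text \<open>
  An embedded 4-cycle, as a subgraph, is recorded by its set of edges, which is independent
  of the choice of a starting point and of an orientation. Different 4-cycles on the same four
  vertices are distinguished.
\<close>

definition four_cycles :: "('v, 'm) graph_scheme \<Rightarrow> 'v set set set" where
  "four_cycles G = {cycle_edges c | c. embedded_cycle G c \<and> length c = 4}"

section \<open>Simplicial complexes and their geometric realizations\<close>

definition simplicial_cx :: "'v set set \<Rightarrow> bool" where
  "simplicial_cx K \<longleftrightarrow>
     (\<forall>s\<in>K. finite s \<and> s \<noteq> {}) \<and> (\<forall>s\<in>K. \<forall>t. t \<subseteq> s \<and> t \<noteq> {} \<longrightarrow> t \<in> K)"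

definition one_skeleton :: "'v set set \<Rightarrow> 'v graph" where
  "one_skeleton K = \<lparr>verts = \<Union>K, edges = {e \<in> K. card e = 2}\<rparr>"

definition link :: "'v set set \<Rightarrow> 'v \<Rightarrow> 'v graph" where
  "link K v =
     \<lparr>verts = {w. {v, w} \<in> edges (one_skeleton K)},
      edges = {{x, y} | x y. {v, x, y} \<in> K \<and> card {v, x, y} = 3}\<rparr>"

text \<open>Points of the realization are given by their barycentric coordinates.\<close>

definition geom_simplex :: "'v set \<Rightarrow> ('v \<Rightarrow> real) set" where
  "geom_simplex s = {x. (\<forall>v. 0 \<le> x v) \<and> (\<forall>v. v \<notin> s \<longrightarrow> x v = 0) \<and> sum x s = 1}"

definition realization_points :: "'v set set \<Rightarrow> ('v \<Rightarrow> real) set" where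
  "realization_points K = (\<Union>s\<in>K. geom_simplex s)"

text \<open>
  The realization carries the weak (CW) topology with respect to its closed simplices. The
  topology of a single simplex, of which only finitely many coordinates are nonzero, is
  Euclidean, i.e. the one induced by the product topology on functions.
\<close>

definition realization_open :: "'v set set \<Rightarrow> ('v \<Rightarrow> real) set \<Rightarrow> bool" where
  "realization_open K U \<longleftrightarrow>
     U \<subseteq> realization_points K \<and>
     (\<forall>s\<in>K. openin (top_of_set (geom_simplex s)) (U \<inter> geom_simplex s))"

definition realization :: "'v set set \<Rightarrow> ('v \<Rightarrow> real) topology" where
  "realization K = topology (realization_open K)"

lemma istopology_realization_open: "istopology (realization_open K)"
  unfolding istopology_def
proof (intro conjI allI impI)
  fix S T assume "realization_open K S" "realization_open K T"
  moreover have "S \<inter> T \<inter> geom_simplex s = (S \<inter> geom_simplex s) \<inter> (T \<inter> geom_simplex s)" for s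
    by blast
  ultimately show "realization_open K (S \<inter> T)"
    unfolding realization_open_def by (metis inf.coboundedI1 openin_Int)
next
  fix \<K> assume *: "\<forall>S\<in>\<K>. realization_open K S"
  have "openin (top_of_set (geom_simplex s)) (\<Union>\<K> \<inter> geom_simplex s)" if "s \<in> K" for s
  proof -
    have "\<Union>\<K> \<inter> geom_simplex s = (\<Union>S\<in>\<K>. S \<inter> geom_simplex s)"
      by blast
    moreover have "openin (top_of_set (geom_simplex s)) (\<Union>S\<in>\<K>. S \<inter> geom_simplex s)"
      using * that unfolding realization_open_def by (intro openin_Union) blast
    ultimately show ?thesis
      by simp
  qed
  with * show "realization_open K (\<Union>\<K>)"
    unfolding realization_open_def by blast
qed

lemma openin_realization: "openin (realization K) U \<longleftrightarrow> realization_open K U"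
  by (simp add: realization_def istopology_realization_open)

lemma topspace_realization: "topspace (realization K) = realization_points K"
proof -
  have "realization_open K (realization_points K)"
    unfolding realization_open_def
  proof (intro conjI ballI)
    fix s assume "s \<in> K"
    then have "realization_points K \<inter> geom_simplex s = geom_simplex s"
      by (auto simp: realization_points_def)
    then show "openin (top_of_set (geom_simplex s)) (realization_points K \<inter> geom_simplex s)"
      by simp
  qed simp
  then show ?thesis
    unfolding topspace_def openin_realization by (auto simp: realization_open_def)
qed

text \<open>
  The definition of \<^const>\<open>simply_connected\<close>, with abstract topologies in place of subsets
  of a topological space: any two loops are freely homotopic. Applied to constant loops, it
  includes path connectedness.
\<close>

definition simply_connected_top :: "'a topology \<Rightarrow> bool" where
  "simply_connected_top X \<longleftrightarrow>
     (\<forall>p q. pathin X p \<and> p 1 = p 0 \<and> pathin X q \<and> q 1 = q 0 \<longrightarrow>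
        homotopic_with (\<lambda>r. r 1 = r 0) (top_of_set {0..1}) X p q)"

text \<open>Being 2-dimensional is understood as having dimension at most 2.\<close>

definition systolic_2cx :: "'v set set \<Rightarrow> bool" where
  "systolic_2cx Y \<longleftrightarrow>
     simplicial_cx Y \<and> (\<forall>s\<in>Y. card s \<le> 3) \<and>
     simply_connected_top (realization Y) \<and>
     (\<forall>v\<in>\<Union>Y. girth (link Y v) \<ge> 6)"

section \<open>Square complexes\<close>

text \<open>
  The squares are given by their boundary 4-cycles; in particular no two squares are glued
  to the same 4-cycle.
\<close>

record 'v square_cx = "'v graph" +
  squares :: "'v set set set"

definition square_complex :: "'v square_cx \<Rightarrow> bool" where
  "square_complex X \<longleftrightarrow> simplicial_graph X \<and> squares X \<subseteq> four_cycles X"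

text \<open>
  The underlying CW complex of a square complex. A 2-cell attached along an embedded cycle is
  a cone over this cycle, so the CW complex is realized by the simplicial complex obtained from
  the 1-skeleton by adding, for each square \<open>q\<close>, a cone with a new apex \<open>Inr q\<close> over the
  boundary cycle of \<open>q\<close> (that is, by subdividing each square into four triangles at its centre).
\<close>

definition coned_cx :: "'v square_cx \<Rightarrow> ('v + 'v set set) set set" where
  "coned_cx X =
     {{Inl v} | v. v \<in> verts X} \<union> {Inl ` e | e. e \<in> edges X} \<union>
     {{Inr q} | q. q \<in> squares X} \<union>
     {{Inr q, Inl v} | q v. q \<in> squares X \<and> v \<in> \<Union>q} \<union>
     {insert (Inr q) (Inl ` e) | q e. q \<in> squares X \<and> e \<in> q}"

definition square_realization :: "'v square_cx \<Rightarrow> ('v + 'v set set \<Rightarrow> real) topology" where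
  "square_realization X = realization (coned_cx X)"

definition bounds_square :: "'v square_cx \<Rightarrow> 'v \<Rightarrow> 'v \<Rightarrow> 'v \<Rightarrow> 'v \<Rightarrow> bool" where
  "bounds_square X a b c d \<longleftrightarrow> cycle_edges [a, b, c, d] \<in> squares X"

definition replacement_A :: "'v square_cx \<Rightarrow> bool" where
  "replacement_A X \<longleftrightarrow>
     (\<forall>u0 u1 v0 v1 v2.
        distinct [u0, u1, v0, v1, v2] \<and>
        {u0, u1, v0, v1, v2} \<subseteq> verts X \<and>
        bounds_square X u0 v0 u1 v1 \<and> bounds_square X u0 v1 u1 v2 \<longrightarrow>
        bounds_square X u0 v0 u1 v2)"

definition replacement_B :: "'v square_cx \<Rightarrow> bool" where
  "replacement_B X \<longleftrightarrow>
     (\<forall>u a0 a1 a2 b0 b1 b2.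
        distinct [u, a0, a1, a2, b0, b1, b2] \<and>
        {u, a0, a1, a2, b0, b1, b2} \<subseteq> verts X \<and>
        bounds_square X u a0 b0 a1 \<and> bounds_square X u a1 b1 a2 \<and>
        bounds_square X u a2 b2 a0 \<longrightarrow>
        {b2, a1} \<in> edges X \<and> bounds_square X b2 a0 b0 a1 \<and> bounds_square X a1 b1 a2 b2 \<or>
        {a0, b1} \<in> edges X \<and> bounds_square X a0 b0 a1 b1 \<and> bounds_square X b1 a2 b2 a0 \<or>
        {a2, b0} \<in> edges X \<and> bounds_square X b0 a1 b1 a2 \<and> bounds_square X a2 b2 a0 b0)"

definition quadric_complex :: "'v square_cx \<Rightarrow> bool" where
  "quadric_complex X \<longleftrightarrow>
     square_complex X \<and> simply_connected_top (square_realization X) \<and>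
     replacement_A X \<and> replacement_B X"

section \<open>Squaring\<close>

definition squaring_graph :: "'v set set \<Rightarrow> 'v \<Rightarrow> 'v graph" where
  "squaring_graph Y b =
     \<lparr>verts = verts (one_skeleton Y),
      edges = {{x, y} | x y. {x, y} \<in> edges (one_skeleton Y) \<and>
        graph_dist (one_skeleton Y) b x \<noteq> graph_dist (one_skeleton Y) b y}\<rparr>"

definition squaring :: "'v set set \<Rightarrow> 'v \<Rightarrow> 'v square_cx" where
  "squaring Y b =
     \<lparr>verts = verts (squaring_graph Y b), edges = edges (squaring_graph Y b),
      squares = four_cycles (squaring_graph Y b)\<rparr>"

end

theory Submission
  imports Defs
begin

text \<open>
  Let \<open>l\<close> be the distance to the basepoint in a 2-dimensional systolic complex. The neighbours
  of a vertex at the previous level are a single vertex or two adjacent ones, and the two ends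
  of an edge within a level have a common neighbour one level below. This is shown by building
  the universal cover level by level, starting from the basepoint: when the links have no cycles
  of length 3, 4 or 5, a vertex of the next level is forced to be identified with at most one
  other, and the new level has the same local structure as the previous ones. Since the complex
  is simply connected, lifts of closed walks are closed (subdivide a null-homotopy into a grid
  so fine that each cell lies in an open star), so the cover is the complex itself.

  It follows that a 4-cycle of the squaring consists of two triangles glued along an edge within a
  level. Rule (A) is immediate because all 4-cycles bound squares. Three squares as in rule (B)
  would give a cycle of length at most 6 in the link of \<open>u\<close>; it then has length exactly 6, and
  this forces some vertex to have three lower neighbours, so (B) is vacuous. Finally,
  loops in the squaring are, up to homotopy, edge loops, and these are contracted by pushing their
  highest vertices down across squares.
\<close>

section \<open>The topology of the realization\<close>

text \<open>The girth condition concerns single links, whereas the facts about levels are global: in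
  the complex itself two vertices of a level might coincide for reasons far away. In the cover a
  vertex is a record of its label and its lower neighbours, two vertices are identified exactly when
  their records agree, and each step of the induction inspects one link at a time. Simple
  connectivity of the given complex enters only to show that every vertex has exactly one lift. The
  bound 6 comes from the following cycle. In a link, the lower neighbours form at most an edge, and
  each horizontal neighbour hangs on one of them. Two horizontal neighbours with a common upper
  neighbour close up through one or two lower neighbours, which gives a cycle of length 4 or 5.
  Hence an upper neighbour is shared with at most one horizontal neighbour, and vertices of the next
  level again have at most two lower neighbours.\<close>

lemma simplicial_cx_face: "simplicial_cx K \<Longrightarrow> s \<in> K \<Longrightarrow> t \<subseteq> s \<Longrightarrow> t \<noteq> {} \<Longrightarrow> t \<in> K"
  unfolding simplicial_cx_def by blast

lemma simplicial_cx_finite: "simplicial_cx K \<Longrightarrow> s \<in> K \<Longrightarrow> finite s"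
  unfolding simplicial_cx_def by blast

lemma simplicial_cx_nonempty: "simplicial_cx K \<Longrightarrow> s \<in> K \<Longrightarrow> s \<noteq> {}"
  unfolding simplicial_cx_def by blast

lemma realization_coordinate:
  "continuous_map (realization K) euclideanreal (\<lambda>x. x v)"
  unfolding continuous_map_def
proof (intro conjI allI impI)
  fix U :: "real set" assume U: "openin euclideanreal U"
  let ?V = "{x \<in> topspace (realization K). x v \<in> U}"
  have "openin (top_of_set (geom_simplex s)) (?V \<inter> geom_simplex s)" if "s \<in> K" for s
  proof -
    have "?V \<inter> geom_simplex s = geom_simplex s \<inter> (\<lambda>x. x v) -` U"
      using that unfolding topspace_realization realization_points_def by blast
    moreover have "continuous_on (geom_simplex s) (\<lambda>x. x v)"
      by (rule continuous_on_subset[OF continuous_on_product_coordinates]) simp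
    ultimately show ?thesis
      using U continuous_openin_preimage_gen[of "geom_simplex s" "\<lambda>x. x v" U] by simp
  qed
  then show "openin (realization K) ?V"
    by (simp add: openin_realization realization_open_def topspace_realization)
qed simp

lemma closed_geom_simplex: "closed (geom_simplex s)"
proof -
  have "geom_simplex s = (\<Inter>v. {x. 0 \<le> x v}) \<inter> (\<Inter>v\<in>-s. {x. x v = 0}) \<inter> {x. sum x s = 1}"
    by (auto simp: geom_simplex_def)
  also have "closed \<dots>"
    by (intro closed_Int closed_INT ballI closed_Collect_le closed_Collect_eq continuous_on_sum
        continuous_on_const continuous_on_product_coordinates)
  finally show ?thesis .
qed

lemma closed_singleton_fun: "closed {x :: 'v \<Rightarrow> real}"
proof -
  have "{x} = (\<Inter>v. {y. y v = x v})"
    by auto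
  also have "closed \<dots>"
    by (intro closed_INT ballI closed_Collect_eq continuous_on_const continuous_on_product_coordinates)
  finally show ?thesis .
qed

text \<open>The simplices are closed in the product topology, so relative closedness in a simplex is
  absolute closedness. Finite unions of closed pieces can then be handled in the product
  topology.\<close>

lemma closedin_realization:
  "closedin (realization K) C \<longleftrightarrow>
     C \<subseteq> realization_points K \<and> (\<forall>s\<in>K. closed (C \<inter> geom_simplex s))"
proof -
  have "openin (top_of_set (geom_simplex s)) ((realization_points K - C) \<inter> geom_simplex s) \<longleftrightarrow>
        closed (C \<inter> geom_simplex s)" if "s \<in> K" "C \<subseteq> realization_points K" for s
  proof -
    have "(realization_points K - C) \<inter> geom_simplex s = geom_simplex s - C \<inter> geom_simplex s"
      using that by (auto simp: realization_points_def)
    then have "openin (top_of_set (geom_simplex s)) ((realization_points K - C) \<inter> geom_simplex s) \<longleftrightarrow>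
        closedin (top_of_set (geom_simplex s)) (C \<inter> geom_simplex s)"
      by (simp add: closedin_def)
    also have "\<dots> \<longleftrightarrow> closed (C \<inter> geom_simplex s)"
      by (metis closed_geom_simplex closedin_closed_eq closedin_closed_trans inf_le2)
    finally show ?thesis .
  qed
  then show ?thesis
    by (auto simp: closedin_def openin_realization realization_open_def topspace_realization)
qed

text \<open>The weak topology can be finer than that of the coordinates, so coordinatewise
  continuity alone does not suffice. If the image lies in finitely many simplices, the preimage of a
  closed set is the preimage of a finite union of sets that are closed in the product
  topology.\<close>

lemma continuous_map_into_realization:
  assumes L: "finite L" "L \<subseteq> K"
    and F: "\<And>z. z \<in> topspace Z \<Longrightarrow> \<exists>s\<in>L. F z \<in> geom_simplex s"
    and cont: "\<And>v. continuous_map Z euclideanreal (\<lambda>z. F z v)"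
  shows "continuous_map Z (realization K) F"
  unfolding continuous_map_closedin
proof (intro conjI allI impI)
  show "F \<in> topspace Z \<rightarrow> topspace (realization K)"
    using F L(2) by (fastforce simp: topspace_realization realization_points_def)
  fix C assume C: "closedin (realization K) C"
  have "continuous_map Z euclidean F"
    using cont by (simp add: continuous_map_componentwise_UNIV flip: euclidean_product_topology)
  moreover have "closed (\<Union>s\<in>L. C \<inter> geom_simplex s)"
    using C L by (intro closed_UN) (auto simp: closedin_realization)
  then have "closedin euclidean (\<Union>s\<in>L. C \<inter> geom_simplex s)"
    by (simp only: closed_closedin)
  ultimately have "closedin Z {z \<in> topspace Z. F z \<in> (\<Union>s\<in>L. C \<inter> geom_simplex s)}"
    by (rule closedin_continuous_map_preimage)
  also have "{z \<in> topspace Z. F z \<in> (\<Union>s\<in>L. C \<inter> geom_simplex s)} = {z \<in> topspace Z. F z \<in> C}"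
    using F by blast
  finally show "closedin Z {z \<in> topspace Z. F z \<in> C}" .
qed

text \<open>On the realization this is the smallest simplex containing the point. The open star of
  \<open>v\<close> consists of the points whose carrier contains \<open>v\<close>; stars appear only
  in this form.\<close>

definition carrier_of :: "('v \<Rightarrow> real) \<Rightarrow> 'v set" where
  "carrier_of x = {v. 0 < x v}"

lemma carrier_of_geom_simplex:
  assumes "x \<in> geom_simplex s"
  shows "carrier_of x \<subseteq> s" "carrier_of x \<noteq> {}" "x \<in> geom_simplex (carrier_of x)"
proof -
  have x: "\<And>v. 0 \<le> x v" "\<And>v. v \<notin> s \<Longrightarrow> x v = 0" "sum x s = 1"
    using assms by (auto simp: geom_simplex_def)
  show sub: "carrier_of x \<subseteq> s"
    using x(2) by (force simp: carrier_of_def)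
  have "finite s"
    using x(3) by (metis sum.infinite zero_neq_one)
  then have "sum x (carrier_of x) = sum x s"
    using x(1) sub by (intro sum.mono_neutral_left) (auto simp: carrier_of_def order.antisym not_less)
  with x(3) have "sum x (carrier_of x) = 1"
    by simp
  then show "x \<in> geom_simplex (carrier_of x)"
    using x(1) by (auto simp: geom_simplex_def carrier_of_def order.antisym not_less)
  show "carrier_of x \<noteq> {}"
    using \<open>sum x (carrier_of x) = 1\<close> by auto
qed

lemma carrier_of_in:
  assumes "simplicial_cx K" "x \<in> realization_points K"
  shows "carrier_of x \<in> K" "x \<in> geom_simplex (carrier_of x)"
proof -
  obtain s where s: "s \<in> K" "x \<in> geom_simplex s"
    using assms(2) by (auto simp: realization_points_def)
  note c = carrier_of_geom_simplex[OF s(2)]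
  show "x \<in> geom_simplex (carrier_of x)"
    by (rule c(3))
  show "carrier_of x \<in> K"
    using simplicial_cx_face[OF assms(1) s(1) c(1,2)] .
qed

lemma geom_simplex_mono: "finite t \<Longrightarrow> s \<subseteq> t \<Longrightarrow> geom_simplex s \<subseteq> geom_simplex t"
proof
  assume t: "finite t" "s \<subseteq> t"
  fix x :: "'a \<Rightarrow> real"
  assume x: "x \<in> geom_simplex s"
  then have "sum x s = sum x t"
    using t by (intro sum.mono_neutral_left) (auto simp: geom_simplex_def)
  with x t show "x \<in> geom_simplex t"
    by (auto simp: geom_simplex_def)
qed

lemma geom_simplex_convex:
  assumes "x \<in> geom_simplex s" "y \<in> geom_simplex s" "0 \<le> a" "a \<le> (1::real)"
  shows "(\<lambda>v. (1 - a) * x v + a * y v) \<in> geom_simplex s"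
proof -
  have "(\<Sum>v\<in>s. (1 - a) * x v + a * y v) = (1 - a) * sum x s + a * sum y s"
    by (simp add: sum.distrib sum_distrib_left)
  then show ?thesis
    using assms by (simp add: geom_simplex_def)
qed

text \<open>
  One point per carrier gives a closed discrete subset of the realization, so a compact set
  meets only finitely many open simplices.
\<close>

lemma finite_carriers:
  assumes K: "simplicial_cx K" and Z: "compact_space Z" and F: "continuous_map Z (realization K) F"
  shows "finite (carrier_of ` F ` topspace Z)"
proof -
  have FZ: "F ` topspace Z \<subseteq> realization_points K"
    using continuous_map_image_subset_topspace[OF F] by (simp add: topspace_realization)
  have "\<exists>A \<subseteq> F ` topspace Z. inj_on carrier_of A \<and> carrier_of ` F ` topspace Z = carrier_of ` A"
    by (metis subset_image_inj order_refl)
  then obtain A where A: "A \<subseteq> F ` topspace Z" "inj_on carrier_of A"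
    "carrier_of ` F ` topspace Z = carrier_of ` A"
    by blast
  have closed: "closedin (realization K) B" if "B \<subseteq> A" for B
    unfolding closedin_realization
  proof (intro conjI ballI)
    show "B \<subseteq> realization_points K"
      using that A(1) FZ by blast
    fix s assume s: "s \<in> K"
    then have "finite (Pow s)"
      using simplicial_cx_finite[OF K] by simp
    moreover have "carrier_of ` (B \<inter> geom_simplex s) \<subseteq> Pow s"
      using carrier_of_geom_simplex(1) by blast
    moreover have "inj_on carrier_of (B \<inter> geom_simplex s)"
      using A(2) that by (auto intro: inj_on_subset)
    ultimately have "finite (B \<inter> geom_simplex s)"
      by (meson finite_imageD finite_subset)
    then have "closed (\<Union>x\<in>B \<inter> geom_simplex s. {x})"
      by (intro closed_UN ballI closed_singleton_fun)
    then show "closed (B \<inter> geom_simplex s)"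
      by simp
  qed
  have comp: "compactin (realization K) (F ` topspace Z)"
    using image_compactin[OF _ F] Z by (simp add: compact_space_def)
  define U where "U a = topspace (realization K) - (A - {a})" for a
  have "finite A"
  proof (cases "A = {}")
    case False
    have "\<forall>V\<in>U ` A. openin (realization K) V"
      using closed by (auto simp: U_def)
    moreover have "F ` topspace Z \<subseteq> \<Union>(U ` A)"
    proof
      fix y assume y: "y \<in> F ` topspace Z"
      obtain a where "a \<in> A" "y \<in> A \<longrightarrow> a = y"
        using False by blast
      with y FZ show "y \<in> \<Union>(U ` A)"
        unfolding U_def topspace_realization by blast
    qed
    ultimately obtain \<F> where \<F>: "finite \<F>" "\<F> \<subseteq> U ` A" "F ` topspace Z \<subseteq> \<Union>\<F>"
      using comp unfolding compactin_def by meson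
    obtain C where C: "C \<subseteq> A" "finite C" "\<F> = U ` C"
      using finite_subset_image[OF \<F>(1,2)] by blast
    have "A \<subseteq> C"
    proof
      fix a assume a: "a \<in> A"
      then obtain c where "c \<in> C" "a \<in> U c"
        using A(1) \<F>(3) C(3) by blast
      with a C show "a \<in> C"
        by (auto simp: U_def)
    qed
    with C(2) show ?thesis
      by (rule finite_subset[rotated])
  qed simp
  with A(3) show ?thesis
    by simp
qed

lemma carrier_of_openin:
  "openin (realization K) {x \<in> realization_points K. v \<in> carrier_of x}"
proof -
  have "openin (realization K) {x \<in> topspace (realization K). x v \<in> {0<..}}"
    by (rule openin_continuous_map_preimage[OF realization_coordinate]) simp
  then show ?thesis
    by (simp add: topspace_realization carrier_of_def)
qed

text \<open>The straight-line homotopy stays in the union of the two carriers at each time. By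
  \<open>finite_carriers\<close> only finitely many such unions occur, which is what continuity into
  the weak topology asks for.\<close>

lemma homotopic_if_common_simplex:
  assumes K: "simplicial_cx K" and p: "pathin (realization K) p" and q: "pathin (realization K) q"
    and loops: "p 1 = p 0" "q 1 = q 0"
    and common: "\<And>t. t \<in> {0..1} \<Longrightarrow> \<exists>s\<in>K. carrier_of (p t) \<union> carrier_of (q t) \<subseteq> s"
  shows "homotopic_with (\<lambda>r. r 1 = r 0) (top_of_set {0..1}) (realization K) p q"
proof -
  let ?I = "top_of_set {0..1::real}"
  define h where "h = (\<lambda>(a, t) v. (1 - a) * p t v + a * q t v)"
  define L where "L = (\<lambda>(s, t). s \<union> t) ` ((carrier_of ` p ` {0..1}) \<times> (carrier_of ` q ` {0..1})) \<inter> K"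
  have pq: "p t \<in> realization_points K" "q t \<in> realization_points K" if "t \<in> {0..1}" for t
    using that path_image_subset_topspace[OF p] path_image_subset_topspace[OF q]
    by (auto simp: topspace_realization)
  have "finite (carrier_of ` p ` {0..1})" "finite (carrier_of ` q ` {0..1})"
    using finite_carriers[OF K, of ?I] p q
    by (simp_all add: pathin_def compact_space_subtopology)
  then have "finite L"
    by (simp add: L_def)
  moreover have "L \<subseteq> K"
    by (simp add: L_def)
  moreover have "\<exists>s\<in>L. h z \<in> geom_simplex s" if z: "z \<in> topspace (prod_topology ?I ?I)" for z
  proof -
    obtain a t where at: "z = (a, t)" "0 \<le> a" "a \<le> 1" "t \<in> {0..1}"
      using z by (cases z) auto
    let ?s = "carrier_of (p t) \<union> carrier_of (q t)"
    note c = carrier_of_in[OF K pq(1)[OF at(4)]] carrier_of_in[OF K pq(2)[OF at(4)]]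
    obtain s where s: "s \<in> K" "?s \<subseteq> s"
      using common[OF at(4)] by blast
    have "carrier_of (p t) \<noteq> {}"
      by (rule simplicial_cx_nonempty[OF K c(1)])
    then have sK: "?s \<in> K"
      by (intro simplicial_cx_face[OF K s]) simp
    then have "finite ?s"
      by (rule simplicial_cx_finite[OF K])
    then have "p t \<in> geom_simplex ?s" "q t \<in> geom_simplex ?s"
      using c(2,4) geom_simplex_mono by blast+
    then have "h z \<in> geom_simplex ?s"
      unfolding at(1) h_def using geom_simplex_convex at(2,3) by fastforce
    moreover have "?s \<in> L"
      using sK at(4) unfolding L_def by blast
    ultimately show ?thesis
      by blast
  qed
  moreover have "continuous_map (prod_topology ?I ?I) euclideanreal (\<lambda>z. h z v)" for v
  proof -
    have "continuous_map ?I euclideanreal (\<lambda>t. p t v)" "continuous_map ?I euclideanreal (\<lambda>t. q t v)"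
      using p q continuous_map_compose[OF _ realization_coordinate[of K v], of ?I]
      by (simp_all only: pathin_def o_def)
    then have "continuous_on {0..1} (\<lambda>t. p t v)" "continuous_on {0..1} (\<lambda>t. q t v)"
      by (simp_all only: continuous_map_iff_continuous)
    note * = continuous_on_compose2[OF this(1) continuous_on_snd[OF continuous_on_id]]
      continuous_on_compose2[OF this(2) continuous_on_snd[OF continuous_on_id]]
    have "continuous_on ({0..1} \<times> {0..1})
        (\<lambda>z. (1 - fst z) * p (snd z) v + fst z * q (snd z) v)"
      by (intro continuous_on_add continuous_on_mult continuous_on_diff continuous_on_const
          continuous_on_fst continuous_on_id *) auto
    then show ?thesis
      by (simp add: h_def case_prod_unfold)
  qed
  ultimately have "continuous_map (prod_topology ?I ?I) (realization K) h"
    by (rule continuous_map_into_realization)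
  then show ?thesis
    unfolding homotopic_with_def using loops by (intro exI[of _ h]) (auto simp: h_def)
qed

section \<open>Piecewise linear paths and star subdivisions\<close>

text \<open>The coefficients are the hat functions on the grid of mesh \<open>1/N\<close>, so the
  path is at \<open>w i\<close> at time \<open>i/N\<close> and affine in between. Hats of a repeated
  vertex add up, so repetitions in \<open>w\<close> cause no trouble.\<close>

definition pl_path :: "nat \<Rightarrow> (nat \<Rightarrow> 'v) \<Rightarrow> real \<Rightarrow> 'v \<Rightarrow> real" where
  "pl_path N w t v = (\<Sum>i\<le>N. if w i = v then max 0 (1 - \<bar>real N * t - real i\<bar>) else 0)"

lemma pl_on_cell:
  assumes "k < N" "real k \<le> real N * t" "real N * t \<le> real (Suc k)"
  shows "pl_path N w t v = (if w k = v then 1 - (real N * t - real k) else 0) +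
    (if w (Suc k) = v then real N * t - real k else 0)"
proof -
  have "pl_path N w t v = (\<Sum>i\<in>{k, Suc k}. if w i = v then max 0 (1 - \<bar>real N * t - real i\<bar>) else 0)"
    unfolding pl_path_def
  proof (rule sum.mono_neutral_right)
    show "\<forall>i\<in>{..N} - {k, Suc k}. (if w i = v then max 0 (1 - \<bar>real N * t - real i\<bar>) else 0) = 0"
    proof
      fix i assume "i \<in> {..N} - {k, Suc k}"
      then have "i + 1 \<le> k \<or> k + 2 \<le> i"
        by auto
      then have "real i + 1 \<le> real k \<or> real k + 2 \<le> real i"
        by linarith
      with assms(2,3) show "(if w i = v then max 0 (1 - \<bar>real N * t - real i\<bar>) else 0) = 0"
        by auto
    qed
  qed (use assms(1) in auto)
  then show ?thesis
    using assms(2,3) by (simp add: max_def)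
qed

lemma pl_in_simplex:
  assumes "k < N" "real k \<le> real N * t" "real N * t \<le> real (Suc k)"
    and "finite s" "w k \<in> s" "w (Suc k) \<in> s"
  shows "pl_path N w t \<in> geom_simplex s"
  using assms unfolding geom_simplex_def pl_on_cell[OF assms(1-3)]
  by (auto simp: sum.distrib)

lemma carrier_of_pl:
  assumes "k < N" "real k \<le> real N * t" "real N * t \<le> real (Suc k)"
  shows "carrier_of (pl_path N w t) \<subseteq> {w k, w (Suc k)}"
  by (rule carrier_of_geom_simplex(1)[OF pl_in_simplex[OF assms]]) simp_all

lemma unit_interval_cell:
  assumes "0 \<le> t" "t \<le> 1" "0 < N"
  obtains k where "k < N" "real k \<le> real N * t" "real N * t \<le> real (Suc k)"
proof (cases "t = 1")
  case True
  with assms(3) show ?thesis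
    by (intro that[of "N - 1"]) auto
next
  case False
  have "real N * t < real N"
    using assms False by simp
  moreover have "0 \<le> real N * t"
    using assms by simp
  ultimately show ?thesis
    by (intro that[of "nat \<lfloor>real N * t\<rfloor>"]) linarith+
qed

lemma pathin_pl:
  assumes "simplicial_cx K" "0 < N" and w: "\<And>i. i < N \<Longrightarrow> {w i, w (Suc i)} \<in> K"
  shows "pathin (realization K) (pl_path N w)"
  unfolding pathin_def
proof (rule continuous_map_into_realization[where L = "(\<lambda>i. {w i, w (Suc i)}) ` {..<N}"])
  fix t :: real assume "t \<in> topspace (top_of_set {0..1})"
  then obtain k where "k < N" "real k \<le> real N * t" "real N * t \<le> real (Suc k)"
    using unit_interval_cell[OF _ _ assms(2)] by auto
  then show "\<exists>s\<in>(\<lambda>i. {w i, w (Suc i)}) ` {..<N}. pl_path N w t \<in> geom_simplex s"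
    using pl_in_simplex[of k N t "{w k, w (Suc k)}" w] by auto
next
  fix v
  have "continuous_on {0..1} (\<lambda>t. if w i = v then max 0 (1 - \<bar>real N * t - real i\<bar>) else 0)" for i
    by (cases "w i = v") (auto intro!: continuous_intros)
  then show "continuous_map (top_of_set {0..1}) euclideanreal (\<lambda>t. pl_path N w t v)"
    unfolding pl_path_def continuous_map_iff_continuous by (rule continuous_on_sum)
qed (use w in auto)

lemma pl_closed:
  assumes "w N = w 0" "0 < N"
  shows "pl_path N w 1 = pl_path N w 0"
proof -
  obtain k where k: "N = Suc k"
    using assms(2) gr0_conv_Suc by blast
  show ?thesis
    using pl_on_cell[of k N 1 w] pl_on_cell[of 0 N 0 w] assms by (auto simp: k fun_eq_iff)
qed

lemma pl_const: "0 < N \<Longrightarrow> 0 \<le> t \<Longrightarrow> t \<le> 1 \<Longrightarrow> carrier_of (pl_path N (\<lambda>_. a) t) = {a}"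
  by (rule unit_interval_cell[of t N]; auto simp: carrier_of_def pl_on_cell split: if_splits)

text \<open>The number \<open>\<epsilon>\<close> is a Lebesgue number of the cover of
  \<open>S\<close> by the preimages of open stars, and \<open>g x\<close> is the centre of a star
  that contains the image of the ball around \<open>x\<close>.\<close>

lemma uniform_star_cover:
  fixes F :: "'a :: metric_space \<Rightarrow> 'v \<Rightarrow> real"
  assumes K: "simplicial_cx K" and S: "compact S"
    and F: "continuous_map (top_of_set S) (realization K) F"
  obtains \<epsilon> g where "0 < \<epsilon>"
    "\<And>x y. x \<in> S \<Longrightarrow> y \<in> S \<Longrightarrow> dist x y < \<epsilon> \<Longrightarrow> g x \<in> carrier_of (F y)"
proof -
  have FS: "F x \<in> realization_points K" if "x \<in> S" for x
    using continuous_map_image_subset_topspace[OF F] that by (auto simp: topspace_realization)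
  define \<G> where "\<G> = {G. open G \<and> (\<exists>v. \<forall>y\<in>S \<inter> G. v \<in> carrier_of (F y))}"
  have "S \<subseteq> \<Union>\<G>"
  proof
    fix x assume x: "x \<in> S"
    obtain v where v: "v \<in> carrier_of (F x)"
      using simplicial_cx_nonempty[OF K carrier_of_in(1)[OF K FS[OF x]]] by blast
    have "openin (top_of_set S) {y \<in> S. F y \<in> {z \<in> realization_points K. v \<in> carrier_of z}}"
      using openin_continuous_map_preimage[OF F carrier_of_openin] by simp
    then obtain G where G: "open G"
      "{y \<in> S. F y \<in> {z \<in> realization_points K. v \<in> carrier_of z}} = S \<inter> G"
      unfolding openin_open by blast
    then have "G \<in> \<G>"
      unfolding \<G>_def by blast
    moreover have "x \<in> G"
      using G(2) x v FS[OF x] by blast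
    ultimately show "x \<in> \<Union>\<G>"
      by blast
  qed
  then obtain \<epsilon> where \<epsilon>: "0 < \<epsilon>" "\<And>x. x \<in> S \<Longrightarrow> \<exists>G\<in>\<G>. ball x \<epsilon> \<subseteq> G"
    using Heine_Borel_lemma[OF S, of \<G>] unfolding \<G>_def by (metis (mono_tags, lifting) mem_Collect_eq)
  have "\<exists>v. \<forall>y\<in>S. dist x y < \<epsilon> \<longrightarrow> v \<in> carrier_of (F y)" if x: "x \<in> S" for x
  proof -
    obtain G v where "ball x \<epsilon> \<subseteq> G" "\<forall>y\<in>S \<inter> G. v \<in> carrier_of (F y)"
      using \<epsilon>(2)[OF x] unfolding \<G>_def by blast
    then show ?thesis
      by (intro exI[of _ v]) (auto simp: subset_iff)
  qed
  then obtain g where "\<And>x. x \<in> S \<Longrightarrow> \<forall>y\<in>S. dist x y < \<epsilon> \<longrightarrow> g x \<in> carrier_of (F y)"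
    by metis
  with \<epsilon>(1) show ?thesis
    by (intro that[of \<epsilon> g]) auto
qed

text \<open>Simplicial approximation of a path: \<open>w i\<close> and \<open>w (Suc i)\<close> lie
  in one carrier throughout the \<open>i\<close>-th cell, so they span a simplex, and the edge path
  through \<open>w\<close> runs in common simplices with \<open>p\<close>.\<close>

lemma path_star_subdivision:
  assumes K: "simplicial_cx K" and p: "pathin (realization K) p"
  obtains N w where "0 < N" "p 1 = p 0 \<Longrightarrow> w N = w 0"
    "\<And>i t. i < N \<Longrightarrow> real i \<le> real N * t \<Longrightarrow> real N * t \<le> real (Suc i) \<Longrightarrow>
       w i \<in> carrier_of (p t) \<and> w (Suc i) \<in> carrier_of (p t)"
proof -
  have "compact {0..1::real}"
    by simp
  then obtain \<epsilon> g where \<epsilon>: "0 < \<epsilon>" and g: "\<And>x y. x \<in> {0..1} \<Longrightarrow> y \<in> {0..1} \<Longrightarrow> dist x y < \<epsilon> \<Longrightarrow>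
      g x \<in> carrier_of (p y)"
    using uniform_star_cover[OF K _ p[unfolded pathin_def]] by metis
  \<comment> \<open>For a closed path \<open>w N\<close> has to be \<open>w 0\<close>, while
    \<open>g 1\<close> may differ from \<open>g 0\<close>. As \<open>p 1 = p 0\<close>, the star of
    \<open>g 0\<close> also contains \<open>p\<close> near time 1, so \<open>g 0\<close> may be used
    at both ends once the mesh is below \<open>\<delta>\<close>.\<close>
  obtain \<delta> where \<delta>: "0 < \<delta>"
    "p 1 = p 0 \<Longrightarrow> y \<in> {0..1} \<Longrightarrow> dist y 1 < \<delta> \<Longrightarrow> g 0 \<in> carrier_of (p y)" for y
  proof (cases "p 1 = p 0")
    case True
    have "openin (top_of_set {0..1})
        {y \<in> {0..1}. p y \<in> {z \<in> realization_points K. g 0 \<in> carrier_of z}}" (is "openin _ ?V")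
      using openin_continuous_map_preimage[OF p[unfolded pathin_def] carrier_of_openin] by simp
    moreover have "1 \<in> ?V"
      using True g[of 0 0] \<epsilon> path_finish_in_topspace[OF p] by (auto simp: topspace_realization)
    ultimately obtain \<delta> where "0 < \<delta>" "\<forall>y\<in>{0..1}. dist y 1 < \<delta> \<longrightarrow> y \<in> ?V"
      unfolding openin_euclidean_subtopology_iff by blast
    then show ?thesis
      by (intro that[of \<delta>]) auto
  qed (use that[of 1] in auto)
  obtain N where N: "0 < N" "1 / real N < min \<epsilon> \<delta>"
    using real_arch_invD[of "min \<epsilon> \<delta>"] \<epsilon> \<delta>(1)
    by (metis inverse_eq_divide min_less_iff_conj not_gr_zero)
  define w where "w i = (if i = N \<and> p 1 = p 0 then g 0 else g (real i / real N))" for i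
  have near: "\<bar>real i / real N - t\<bar> < min \<epsilon> \<delta> \<and> real i / real N \<in> {0..1}"
    if "\<bar>real N * t - real i\<bar> \<le> 1" "i \<le> N" for i t
  proof -
    have "real i / real N - t = (real i - real N * t) / real N"
      using N(1) by (simp add: field_simps)
    then have "\<bar>real i / real N - t\<bar> \<le> 1 / real N"
      using that(1) N(1) by (simp add: divide_right_mono abs_minus_commute)
    with N that(2) show ?thesis
      by (auto simp: field_simps)
  qed
  have *: "w i \<in> carrier_of (p t)" if "\<bar>real N * t - real i\<bar> \<le> 1" "i \<le> N" "t \<in> {0..1}" for i t
    using near[OF that(1,2)] that(3) g[of "real i / real N" t] \<delta>(2)[of t] N(1)
    by (auto simp: w_def dist_real_def abs_minus_commute)
  show ?thesis
  proof (rule that[OF N(1)])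
    show "w N = w 0" if "p 1 = p 0"
      using that N(1) by (simp add: w_def)
    fix i t assume i: "i < N" "real i \<le> real N * t" "real N * t \<le> real (Suc i)"
    have "0 \<le> real N * t"
      using i(2) by linarith
    then have "0 \<le> t"
      using N(1) by (simp add: zero_le_mult_iff)
    moreover have "real N * t \<le> real N * 1"
      using i(1,3) by linarith
    then have "t \<le> 1"
      using N(1) by simp
    ultimately show "w i \<in> carrier_of (p t) \<and> w (Suc i) \<in> carrier_of (p t)"
      using i by (intro conjI *) auto
  qed
qed

text \<open>Simple connectivity is formulated by free homotopies, so path connectedness has to be
  extracted: a homotopy between the constant loops at \<open>a\<close> and \<open>b\<close> drags
  the point at time 0 along a path from \<open>a\<close> to \<open>b\<close>. The carriers at its
  ends are \<open>{a}\<close> and \<open>{b}\<close>, which pins down \<open>w 0\<close> and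
  \<open>w N\<close>.\<close>

lemma path_vertices:
  assumes K: "simplicial_cx K" and sc: "simply_connected_top (realization K)"
    and a: "{a} \<in> K" and b: "{b} \<in> K"
  obtains N w where "w 0 = a" "w N = b" "\<And>i. i < N \<Longrightarrow> {w i, w (Suc i)} \<in> K"
proof -
  let ?R = "realization K" and ?I = "top_of_set {0..1::real}"
  have "pathin ?R (pl_path 1 (\<lambda>_. a))" "pathin ?R (pl_path 1 (\<lambda>_. b))"
    using a b by (auto intro!: pathin_pl[OF K])
  moreover have "pl_path 1 (\<lambda>_. a) 1 = pl_path 1 (\<lambda>_. a) 0" "pl_path 1 (\<lambda>_. b) 1 = pl_path 1 (\<lambda>_. b) 0"
    by (rule pl_closed; simp)+
  ultimately have "homotopic_with (\<lambda>r. r 1 = r 0) ?I ?R (pl_path 1 (\<lambda>_. a)) (pl_path 1 (\<lambda>_. b))"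
    using sc unfolding simply_connected_top_def by blast
  then obtain h where h: "continuous_map (prod_topology ?I ?I) ?R h"
    "\<And>t. h (0, t) = pl_path 1 (\<lambda>_. a) t" "\<And>t. h (1, t) = pl_path 1 (\<lambda>_. b) t"
    unfolding homotopic_with_def by blast
  have "continuous_map ?I (prod_topology ?I ?I) (\<lambda>s. (s, 0))"
    by (intro continuous_map_pairedI) auto
  then have p: "pathin ?R (\<lambda>s. h (s, 0))"
    using continuous_map_compose[OF _ h(1)] unfolding pathin_def o_def by blast
  obtain N w where N: "0 < N"
    "\<And>i t. i < N \<Longrightarrow> real i \<le> real N * t \<Longrightarrow> real N * t \<le> real (Suc i) \<Longrightarrow>
       w i \<in> carrier_of (h (t, 0)) \<and> w (Suc i) \<in> carrier_of (h (t, 0))"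
    using path_star_subdivision[OF K p] by metis
  show ?thesis
  proof (rule that[of w N])
    show "w 0 = a"
      using N(2)[of 0 0] N(1) pl_const[of 1 0 a] by (simp add: h)
    show "w N = b"
      using N(2)[of "N - 1" 1] N(1) pl_const[of 1 0 b] by (simp add: h)
    fix i assume i: "i < N"
    define t where "t = real i / real N"
    have t: "real N * t = real i" "t \<in> {0..1}"
      using N(1) i by (auto simp: t_def)
    have "h (t, 0) \<in> realization_points K"
      using path_image_subset_topspace[OF p] t(2) by (auto simp: topspace_realization)
    then have "carrier_of (h (t, 0)) \<in> K"
      by (rule carrier_of_in(1)[OF K])
    then show "{w i, w (Suc i)} \<in> K"
      using N(2)[OF i, of t] t(1)
        simplicial_cx_face[OF K, of "carrier_of (h (t, 0))" "{w i, w (Suc i)}"] by simp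
  qed
qed

lemma homotopy_star_grid:
  assumes K: "simplicial_cx K"
    and h: "continuous_map (prod_topology (top_of_set {0..1}) (top_of_set {0..1})) (realization K) h"
  obtains N0 where "\<And>N. N0 \<le> N \<Longrightarrow> \<exists>w. \<forall>i<N. \<forall>j<N. \<forall>s t.
       real i \<le> real N * s \<longrightarrow> real N * s \<le> real (Suc i) \<longrightarrow>
       real j \<le> real N * t \<longrightarrow> real N * t \<le> real (Suc j) \<longrightarrow> w i j \<in> carrier_of (h (s, t))"
proof -
  let ?S = "{0..1::real} \<times> {0..1::real}"
  have "compact ?S"
    by (intro compact_Times) auto
  moreover have "continuous_map (top_of_set ?S) (realization K) h"
    using h by simp
  ultimately obtain \<epsilon> g where \<epsilon>: "0 < \<epsilon>" and g: "\<And>x y. x \<in> ?S \<Longrightarrow> y \<in> ?S \<Longrightarrow> dist x y < \<epsilon> \<Longrightarrow>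
      g x \<in> carrier_of (h y)"
    using uniform_star_cover[OF K] by metis
  obtain N0 where N0: "2 / \<epsilon> < real N0"
    using reals_Archimedean2 by blast
  show ?thesis
  proof (rule that[of N0], intro exI allI impI)
    fix N i j s t
    assume N: "N0 \<le> N" and ij: "i < N" "j < N"
      and s: "real i \<le> real N * s" "real N * s \<le> real (Suc i)"
      and t: "real j \<le> real N * t" "real N * t \<le> real (Suc j)"
    have pos: "0 < real N"
      using ij(1) by simp
    have *: "\<bar>real k / real N - u\<bar> \<le> 1 / real N \<and> real k / real N \<in> {0..1} \<and> u \<in> {0..1}"
      if "k < N" "real k \<le> real N * u" "real N * u \<le> real (Suc k)" for k u
    proof -
      have "real k / real N - u = (real k - real N * u) / real N"
        using pos by (simp add: field_simps)
      moreover have "\<bar>real k - real N * u\<bar> \<le> 1"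
        using that(2,3) by linarith
      ultimately have "\<bar>real k / real N - u\<bar> \<le> 1 / real N"
        using pos by (simp add: divide_right_mono)
      moreover have "0 \<le> real N * u" "real N * u \<le> real N * 1"
        using that by linarith+
      then have "0 \<le> u" "u \<le> 1"
        using pos by (simp_all add: zero_le_mult_iff)
      ultimately show ?thesis
        using that(1) pos by simp
    qed
    have "2 < real N * \<epsilon>"
      using N0 N \<epsilon> by (smt (verit) divide_less_eq mult_right_mono of_nat_mono)
    then have "1 / real N + 1 / real N < \<epsilon>"
      using pos by (simp add: field_simps)
    moreover have "dist (real i / real N, real j / real N) (s, t) \<le>
        \<bar>real i / real N - s\<bar> + \<bar>real j / real N - t\<bar>"
      unfolding dist_Pair_Pair dist_real_def
      using sqrt_sum_squares_le_sum_abs[of "real i / real N - s" "real j / real N - t"] by simp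
    ultimately have "dist (real i / real N, real j / real N) (s, t) < \<epsilon>"
      using *[OF ij(1) s] *[OF ij(2) t] by linarith
    then show "g (real i / real N, real j / real N) \<in> carrier_of (h (s, t))"
      using *[OF ij(1) s] *[OF ij(2) t] by (intro g) auto
  qed
qed

section \<open>Monodromy of simplicial covers\<close>

text \<open>Here \<open>T s x\<close> is the end of the lift at \<open>s\<close> of the edge from
  \<open>lab s\<close> to \<open>x\<close>. A lifting rule on vertices that respects triangles is
  enough for monodromy, and no complex on \<open>S\<close> is formed. For \<open>y = lab s\<close>,
  the axioms \<open>T_T\<close> and \<open>T_self\<close> say that an edge followed by its reverse
  lifts to a closed walk.\<close>

locale simplicial_cover =
  fixes K :: "'v set set" and S :: "'s set" and lab :: "'s \<Rightarrow> 'v" and T :: "'s \<Rightarrow> 'v \<Rightarrow> 's"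
  assumes cx: "simplicial_cx K"
    and T_lab: "s \<in> S \<Longrightarrow> {lab s, x} \<in> K \<Longrightarrow> T s x \<in> S \<and> lab (T s x) = x"
    and T_self: "s \<in> S \<Longrightarrow> T s (lab s) = s"
    and T_T: "s \<in> S \<Longrightarrow> {lab s, x, y} \<in> K \<Longrightarrow> T (T s x) y = T s y"
begin

primrec transport :: "'s \<Rightarrow> (nat \<Rightarrow> 'v) \<Rightarrow> nat \<Rightarrow> 's" where
  "transport s a 0 = s"
| "transport s a (Suc j) = T (transport s a j) (a (Suc j))"

lemma edge_subset: "\<sigma> \<in> K \<Longrightarrow> {x, y} \<subseteq> \<sigma> \<Longrightarrow> {x, y} \<in> K"
  using simplicial_cx_face[OF cx, of \<sigma> "{x, y}"] by simp

lemma triple_subset: "\<sigma> \<in> K \<Longrightarrow> {x, y, z} \<subseteq> \<sigma> \<Longrightarrow> {x, y, z} \<in> K"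
  using simplicial_cx_face[OF cx, of \<sigma> "{x, y, z}"] by simp

lemma transport_in:
  assumes "s \<in> S" "lab s = a 0" "\<And>i. i < j \<Longrightarrow> {a i, a (Suc i)} \<in> K"
  shows "transport s a j \<in> S \<and> lab (transport s a j) = a j"
  using assms by (induction j) (auto simp: T_lab)

text \<open>The walks are the sides of a ladder whose cells each lie in a simplex. By
  \<open>T_T\<close> both ways across a cell agree, since both equal the lift of the diagonal from
  \<open>a j\<close> to \<open>b (Suc j)\<close>.\<close>

lemma transport_ladder:
  assumes s: "s \<in> S" "lab s = a 0"
    and ladder: "\<And>i. i < j \<Longrightarrow> \<exists>\<sigma>\<in>K. {a i, a (Suc i), b i, b (Suc i)} \<subseteq> \<sigma>"
  shows "transport (T s (b 0)) b j = T (transport s a j) (b j)"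
  using ladder
proof (induction j)
  case (Suc j)
  obtain \<sigma> where \<sigma>: "\<sigma> \<in> K" "{a j, a (Suc j), b j, b (Suc j)} \<subseteq> \<sigma>"
    using Suc.prems by blast
  have "{a i, a (Suc i)} \<in> K" if "i < j" for i
  proof -
    have "\<exists>\<sigma>\<in>K. {a i, a (Suc i), b i, b (Suc i)} \<subseteq> \<sigma>"
      using Suc.prems[of i] that by simp
    then show ?thesis
      using edge_subset by blast
  qed
  then have t: "transport s a j \<in> S" "lab (transport s a j) = a j"
    using transport_in[of s a j] s by simp_all
  have "{a j, b j, b (Suc j)} \<in> K" "{a j, a (Suc j), b (Suc j)} \<in> K"
    using triple_subset[OF \<sigma>(1)] \<sigma>(2) by simp_all
  then have "T (T (transport s a j) (b j)) (b (Suc j)) = T (T (transport s a j) (a (Suc j))) (b (Suc j))"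
    using T_T[OF t(1)] t(2) by simp
  moreover have "transport (T s (b 0)) b j = T (transport s a j) (b j)"
    using Suc by simp
  ultimately show ?case
    by simp
qed simp

definition trivial_monodromy :: "nat \<Rightarrow> (nat \<Rightarrow> 'v) \<Rightarrow> bool" where
  "trivial_monodromy N a \<longleftrightarrow> (\<forall>s\<in>S. lab s = a 0 \<longrightarrow> transport s a N = s)"

text \<open>Passing to the other side of the ladder conjugates the monodromy by the first rung.
  Triviality is required on the whole fibre, so it survives a change of base point, as a free
  homotopy demands.\<close>

lemma trivial_monodromy_ladder:
  assumes a: "trivial_monodromy N a" "a N = a 0" and b: "b N = b 0" and N: "0 < N"
    and ladder: "\<And>i. i < N \<Longrightarrow> \<exists>\<sigma>\<in>K. {a i, a (Suc i), b i, b (Suc i)} \<subseteq> \<sigma>"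
  shows "trivial_monodromy N b"
  unfolding trivial_monodromy_def
proof (intro ballI impI)
  fix s' assume s': "s' \<in> S" "lab s' = b 0"
  obtain \<sigma> where \<sigma>: "\<sigma> \<in> K" "{a 0, a 1, b 0, b 1} \<subseteq> \<sigma>"
    using ladder[OF N] by auto
  have ba: "{b 0, a 0} \<in> K" "{b 0, a 0, b 0} \<in> K"
    using edge_subset[OF \<sigma>(1)] triple_subset[OF \<sigma>(1)] \<sigma>(2) by simp_all
  let ?s = "T s' (a 0)"
  have s: "?s \<in> S" "lab ?s = a 0"
    using T_lab[OF s'(1)] ba(1) s'(2) by simp_all
  have ret: "T ?s (b 0) = s'"
    using T_T[OF s'(1)] ba(2) s'(2) T_self[OF s'(1)] by metis
  have "transport s' b N = T (transport ?s a N) (b N)"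
    using transport_ladder[of ?s a N b] s ladder ret by simp
  then show "transport s' b N = s'"
    using a(1) s ret b by (simp add: trivial_monodromy_def)
qed

theorem monodromy:
  assumes sc: "simply_connected_top (realization K)"
    and \<sigma>: "\<And>i. i \<le> n \<Longrightarrow> \<sigma> i \<in> S"
      "\<And>i. i < n \<Longrightarrow> {lab (\<sigma> i), lab (\<sigma> (Suc i))} \<in> K"
      "\<And>i. i < n \<Longrightarrow> \<sigma> (Suc i) = T (\<sigma> i) (lab (\<sigma> (Suc i)))"
    and closed: "lab (\<sigma> n) = lab (\<sigma> 0)"
  shows "\<sigma> n = \<sigma> 0"
proof (cases "n = 0")
  case False
  then have n: "0 < n"
    by simp
  let ?R = "realization K" and ?I = "top_of_set {0..1::real}"
  define x where "x i = lab (\<sigma> i)" for i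
  let ?c = "\<lambda>_::nat. x 0"
  have "{x 0} \<in> K"
    using simplicial_cx_face[OF cx \<sigma>(2)[OF n], of "{x 0}"] by (simp add: x_def)
  then have "pathin ?R (pl_path n x)" "pathin ?R (pl_path 1 ?c)"
    using \<sigma>(2) n by (auto intro!: pathin_pl[OF cx] simp: x_def)
  moreover have xcl: "pl_path n x 1 = pl_path n x 0" "pl_path 1 ?c 1 = pl_path 1 ?c 0"
    using closed n by (auto intro!: pl_closed simp: x_def)
  ultimately have "homotopic_with (\<lambda>r. r 1 = r 0) ?I ?R (pl_path n x) (pl_path 1 ?c)"
    using sc unfolding simply_connected_top_def by blast
  then obtain h where h: "continuous_map (prod_topology ?I ?I) ?R h"
    "\<And>t. h (0, t) = pl_path n x t" "\<And>t. h (1, t) = pl_path 1 ?c t"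
    "\<And>t. t \<in> {0..1} \<Longrightarrow> h (t, 1) = h (t, 0)"
    unfolding homotopic_with_def by blast
  have hK: "carrier_of (h (s, t)) \<in> K" if "s \<in> {0..1}" "t \<in> {0..1}" for s t
    using continuous_map_image_subset_topspace[OF h(1)] that
    by (intro carrier_of_in(1)[OF cx]) (auto simp: topspace_realization)
  obtain N0 where N0: "\<And>N. N0 \<le> N \<Longrightarrow> \<exists>w. \<forall>i<N. \<forall>j<N. \<forall>s t.
       real i \<le> real N * s \<longrightarrow> real N * s \<le> real (Suc i) \<longrightarrow>
       real j \<le> real N * t \<longrightarrow> real N * t \<le> real (Suc j) \<longrightarrow> w i j \<in> carrier_of (h (s, t))"
    using homotopy_star_grid[OF cx h(1)] by blast
  \<comment> \<open>With \<open>N\<close> a multiple of \<open>n\<close> every edge of the walk is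
    cut into \<open>m\<close> equal pieces, and \<open>Suc\<close> keeps \<open>m\<close>
    positive.\<close>
  define m where "m = Suc N0"
  define N where "N = n * m"
  have m: "0 < m"
    by (simp add: m_def)
  have "m \<le> N"
    using n by (simp add: N_def)
  then have N: "N0 \<le> N" "0 < N"
    by (simp_all add: m_def)
  obtain w where w: "\<And>i j s t. i < N \<Longrightarrow> j < N \<Longrightarrow>
       real i \<le> real N * s \<Longrightarrow> real N * s \<le> real (Suc i) \<Longrightarrow>
       real j \<le> real N * t \<Longrightarrow> real N * t \<le> real (Suc j) \<Longrightarrow> w i j \<in> carrier_of (h (s, t))"
    using N0[OF N(1)] by blast
  \<comment> \<open>The grid has cells \<open>0, ..., N - 1\<close> only. Reading the column modulo
    \<open>N\<close> closes each row, which is legitimate because every stage of the homotopy is a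
    loop.\<close>
  define row where "row i j = w i (j mod N)" for i j
  have row_closed: "row i N = row i 0" for i
    by (simp add: row_def)
  have row: "row i j \<in> carrier_of (h (s, real j / real N)) \<and>
      row i (Suc j) \<in> carrier_of (h (s, real (Suc j) / real N)) \<and>
      row i j \<in> carrier_of (h (s, real (Suc j) / real N))"
    if "i < N" "j < N" "real i \<le> real N * s" "real N * s \<le> real (Suc i)" "s \<in> {0..1}" for i j s
  proof -
    have 1: "row i j \<in> carrier_of (h (s, real j / real N))"
      "row i j \<in> carrier_of (h (s, real (Suc j) / real N))"
      unfolding row_def using w[OF that(1,2,3,4)] that(2) N(2) by simp_all
    have "row i (Suc j) \<in> carrier_of (h (s, real (Suc j) / real N))"
    proof (cases "Suc j = N")
      case True
      then have "row i (Suc j) \<in> carrier_of (h (s, 0))"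
        unfolding row_def using w[OF that(1) N(2) that(3,4), of 0] by simp
      then show ?thesis
        using h(4)[OF that(5)] True N(2) by simp
    next
      case False
      then show ?thesis
        unfolding row_def using w[OF that(1) _ that(3,4), of "Suc j" "real (Suc j) / real N"] that(2) N(2)
        by simp
    qed
    with 1 show ?thesis
      by blast
  qed
  have unit: "real j / real N \<in> {0..1}" if "j \<le> N" for j
    using that N(2) by simp
  have last_row: "row (N - 1) j = x 0" if "j < N" for j
  proof -
    have "row (N - 1) j \<in> carrier_of (h (1, real j / real N))"
      using row[of "N - 1" j 1] that N(2) by auto
    also have "\<dots> = {x 0}"
      using pl_const[of 1 "real j / real N" "x 0"] unit[of j] that by (simp add: h(3))
    finally show ?thesis
      by simp
  qed
  have const: "transport s ?c j = s" if s: "s \<in> S" "lab s = x 0" for s j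
    by (induction j) (use T_self[OF s(1)] s(2) in simp_all)
  have "trivial_monodromy N (row (N - 1 - k))" if "k < N" for k
    using that
  proof (induction k)
    case 0
    have "row (N - 1) j = x 0" for j
      using last_row[of "j mod N"] N(2) by (simp add: row_def)
    then have "row (N - 1) = ?c"
      by (simp add: fun_eq_iff)
    then show ?case
      using const by (simp add: trivial_monodromy_def)
  next
    case (Suc k)
    let ?i = "N - 1 - Suc k"
    have i: "N - 1 - k = Suc ?i" "Suc ?i < N"
      using Suc.prems by linarith+
    show ?case
    proof (rule trivial_monodromy_ladder[OF _ row_closed row_closed N(2)])
      show "trivial_monodromy N (row (Suc ?i))"
        using Suc i by simp
      fix j assume j: "j < N"
      \<comment> \<open>This point is the common corner of the four cells involved, so its carrier
        contains all four of their vertices and is the simplex that the ladder needs.\<close>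
      let ?s = "real (Suc ?i) / real N" and ?t = "real (Suc j) / real N"
      have "?s \<in> {0..1}" "?t \<in> {0..1}"
        using unit i(2) j by (meson less_imp_le_nat Suc_leI)+
      moreover have "real N * ?s = real (Suc ?i)"
        using N(2) by simp
      ultimately have "{row (Suc ?i) j, row (Suc ?i) (Suc j), row ?i j, row ?i (Suc j)} \<subseteq>
          carrier_of (h (?s, ?t))"
        using row[of "Suc ?i" j ?s] row[of ?i j ?s] i(2) j by simp
      then show "\<exists>\<sigma>\<in>K. {row (Suc ?i) j, row (Suc ?i) (Suc j), row ?i j, row ?i (Suc j)} \<subseteq> \<sigma>"
        using hK \<open>?s \<in> {0..1}\<close> \<open>?t \<in> {0..1}\<close> by blast
    qed
  qed
  from this[of "N - 1"] have row0: "trivial_monodromy N (row 0)"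
    using N(2) by simp
  \<comment> \<open>The walk itself, with each vertex repeated \<open>m\<close> times, so that it
    has the length of a row and can form a ladder with row 0.\<close>
  define x' where "x' j = x (j div m)" for j
  have "trivial_monodromy N x'"
  proof (rule trivial_monodromy_ladder[OF row0 row_closed _ N(2)])
    show "x' N = x' 0"
      using closed m by (simp add: x'_def N_def x_def)
    fix j assume j: "j < N"
    define k where "k = j div m"
    have k: "k < n" "k * m \<le> j" "Suc j \<le> Suc k * m"
      using j m unfolding k_def N_def
      by (auto simp: less_mult_imp_div_less dividend_less_div_times Suc_le_eq)
    have "x' (Suc j) \<in> {x k, x (Suc k)}"
      by (simp add: x'_def div_Suc k_def)
    moreover have "row 0 j \<in> {x k, x (Suc k)} \<and> row 0 (Suc j) \<in> {x k, x (Suc k)}"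
    proof -
      have "real n * (real (Suc j) / real N) = real (Suc j) / real m"
        using n by (simp add: N_def)
      moreover have "real k * real m \<le> real j" "real (Suc j) \<le> real (Suc k) * real m"
        using k(2,3) by (metis of_nat_le_iff of_nat_mult)+
      ultimately have "real k \<le> real n * (real (Suc j) / real N)"
        "real n * (real (Suc j) / real N) \<le> real (Suc k)"
        using m by (simp_all add: pos_le_divide_eq pos_divide_le_eq)
      then have "carrier_of (h (0, real (Suc j) / real N)) \<subseteq> {x k, x (Suc k)}"
        unfolding h(2) by (rule carrier_of_pl[OF k(1)])
      then show ?thesis
        using row[of 0 j 0] j N(2) by auto
    qed
    moreover have "x' j = x k"
      by (simp add: x'_def k_def)
    ultimately have "{row 0 j, row 0 (Suc j), x' j, x' (Suc j)} \<subseteq> {x k, x (Suc k)}"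
      by simp
    then show "\<exists>\<sigma>\<in>K. {row 0 j, row 0 (Suc j), x' j, x' (Suc j)} \<subseteq> \<sigma>"
      using \<sigma>(2)[OF k(1)] unfolding x_def by blast
  qed
  \<comment> \<open>Transport along the stretched walk moves only at multiples of \<open>m\<close>;
    at the repeated vertices \<open>T_self\<close> keeps it in place.\<close>
  moreover have "transport (\<sigma> 0) x' j = \<sigma> (j div m)" if "j \<le> N" for j
    using that
  proof (induction j)
    case (Suc j)
    then have "j div m < n"
      by (simp add: N_def less_mult_imp_div_less)
    then show ?case
      using Suc \<sigma>(1)[of "j div m"] \<sigma>(3)[of "j div m"] T_self by (simp add: x'_def x_def div_Suc)
  qed simp
  then have "transport (\<sigma> 0) x' N = \<sigma> n"
    using m by (simp add: N_def)
  ultimately show ?thesis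
    using \<sigma>(1)[of 0] by (simp add: trivial_monodromy_def x'_def x_def)
qed simp

end

section \<open>Contracting loops in graded square complexes\<close>

definition vertex_loop :: "'a set set \<Rightarrow> nat \<Rightarrow> (nat \<Rightarrow> 'a) \<Rightarrow> bool" where
  "vertex_loop K N w \<longleftrightarrow> w N = w 0 \<and> (\<forall>i<N. {w i, w (Suc i)} \<in> K)"

text \<open>Contiguity of simplicial maps, for loops with the same number of segments. Degenerate
  segments are allowed in \<open>vertex_loop\<close>, so a loop can shrink to a point without
  changing \<open>N\<close>.\<close>

definition contiguous :: "'a set set \<Rightarrow> nat \<Rightarrow> (nat \<Rightarrow> 'a) \<Rightarrow> (nat \<Rightarrow> 'a) \<Rightarrow> bool" where
  "contiguous K N w w' \<longleftrightarrow> vertex_loop K N w \<and> vertex_loop K N w' \<and>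
     (\<forall>i<N. \<exists>\<sigma>\<in>K. {w i, w (Suc i), w' i, w' (Suc i)} \<subseteq> \<sigma>)"

lemma contiguous_homotopic:
  assumes K: "simplicial_cx K" and N: "0 < N" and c: "contiguous K N w w'"
  shows "homotopic_with (\<lambda>r. r 1 = r 0) (top_of_set {0..1}) (realization K) (pl_path N w) (pl_path N w')"
proof (rule homotopic_if_common_simplex[OF K])
  note c' = c[unfolded contiguous_def vertex_loop_def]
  show "pathin (realization K) (pl_path N w)" "pathin (realization K) (pl_path N w')"
    using c' by (auto intro!: pathin_pl[OF K N])
  show "pl_path N w 1 = pl_path N w 0" "pl_path N w' 1 = pl_path N w' 0"
    using c' by (auto intro!: pl_closed N)
  fix t :: real assume "t \<in> {0..1}"
  then obtain k where k: "k < N" "real k \<le> real N * t" "real N * t \<le> real (Suc k)"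
    using unit_interval_cell[of t N] N by auto
  then obtain \<sigma> where "\<sigma> \<in> K" "{w k, w (Suc k), w' k, w' (Suc k)} \<subseteq> \<sigma>"
    using c' by blast
  moreover from this have "carrier_of (pl_path N w t) \<union> carrier_of (pl_path N w' t) \<subseteq> \<sigma>"
    using carrier_of_pl[OF k, of w] carrier_of_pl[OF k, of w'] by auto
  ultimately show "\<exists>\<sigma>\<in>K. carrier_of (pl_path N w t) \<union> carrier_of (pl_path N w' t) \<subseteq> \<sigma>"
    by blast
qed

text \<open>A continuous loop is homotopic to the edge loop of its star subdivision, and contiguous
  loops are homotopic. The number of segments depends on the loop, so all of them are compared with
  the one-segment constant loop at \<open>b\<close>.\<close>

lemma simply_connected_topI:
  assumes K: "simplicial_cx K" and b: "{b} \<in> K"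
    and contract: "\<And>N w. 0 < N \<Longrightarrow> vertex_loop K N w \<Longrightarrow> (contiguous K N)\<^sup>*\<^sup>* w (\<lambda>_. b)"
  shows "simply_connected_top (realization K)"
proof -
  let ?H = "homotopic_with (\<lambda>r. r 1 = r 0) (top_of_set {0..1::real}) (realization K)"
  have *: "?H p (pl_path 1 (\<lambda>_. b))" if p: "pathin (realization K) p" "p 1 = p 0" for p
  proof -
    obtain N w where N: "0 < N" "w N = w 0" and
      w: "\<And>i t. i < N \<Longrightarrow> real i \<le> real N * t \<Longrightarrow> real N * t \<le> real (Suc i) \<Longrightarrow>
       w i \<in> carrier_of (p t) \<and> w (Suc i) \<in> carrier_of (p t)"
      using path_star_subdivision[OF K p(1)] p(2) by metis
    have pK: "carrier_of (p t) \<in> K" if "t \<in> {0..1}" for t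
      using path_image_subset_topspace[OF p(1)] that
      by (intro carrier_of_in(1)[OF K]) (auto simp: topspace_realization)
    have edge: "{w i, w (Suc i)} \<in> K" if "i < N" for i
    proof -
      have "real i / real N \<in> {0..1}"
        using that by simp
      then show ?thesis
        using w[OF that, of "real i / real N"] N(1) pK
          simplicial_cx_face[OF K, of "carrier_of (p (real i / real N))" "{w i, w (Suc i)}"]
        by simp
    qed
    then have loop: "vertex_loop K N w"
      using N(2) by (simp add: vertex_loop_def)
    have "?H p (pl_path N w)"
    proof (rule homotopic_if_common_simplex[OF K p(1) _ p(2)])
      show "pathin (realization K) (pl_path N w)"
        using edge by (intro pathin_pl[OF K N(1)])
      show "pl_path N w 1 = pl_path N w 0"
        by (rule pl_closed[of w N, OF N(2,1)])
      fix t :: real assume t: "t \<in> {0..1}"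
      then obtain k where k: "k < N" "real k \<le> real N * t" "real N * t \<le> real (Suc k)"
        using unit_interval_cell[of t N] N by auto
      show "\<exists>\<sigma>\<in>K. carrier_of (p t) \<union> carrier_of (pl_path N w t) \<subseteq> \<sigma>"
        using carrier_of_pl[OF k, of w] w[OF k] pK[OF t]
        by (intro bexI[of _ "carrier_of (p t)"]) auto
    qed
    moreover have "?H (pl_path N w) (pl_path N v)" if "(contiguous K N)\<^sup>*\<^sup>* w v" for v
      using that
    proof (induction rule: rtranclp_induct)
      case base
      have "contiguous K N w w"
        unfolding contiguous_def
      proof (intro conjI loop allI impI)
        fix i assume "i < N"
        then show "\<exists>\<sigma>\<in>K. {w i, w (Suc i), w i, w (Suc i)} \<subseteq> \<sigma>"
          using edge by (intro bexI[of _ "{w i, w (Suc i)}"]) simp_all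
      qed
      then show ?case
        by (rule contiguous_homotopic[OF K N(1)])
    next
      case (step y z)
      show ?case
        by (rule homotopic_with_trans[OF step.IH contiguous_homotopic[OF K N(1) step.hyps(2)]])
    qed
    moreover have "?H (pl_path N (\<lambda>_. b)) (pl_path 1 (\<lambda>_. b))"
    proof (rule homotopic_if_common_simplex[OF K])
      show "pathin (realization K) (pl_path N (\<lambda>_. b))" "pathin (realization K) (pl_path 1 (\<lambda>_. b))"
        using b N(1) by (simp_all add: pathin_pl[OF K])
      show "pl_path N (\<lambda>_. b) 1 = pl_path N (\<lambda>_. b) 0" "pl_path 1 (\<lambda>_. b) 1 = pl_path 1 (\<lambda>_. b) 0"
        using N(1) by (simp_all add: pl_closed)
      fix t :: real assume "t \<in> {0..1}"
      then have "carrier_of (pl_path N (\<lambda>_. b) t) = {b}" "carrier_of (pl_path 1 (\<lambda>_. b) t) = {b}"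
        using N(1) by (simp_all add: pl_const)
      then show "\<exists>\<sigma>\<in>K. carrier_of (pl_path N (\<lambda>_. b) t) \<union> carrier_of (pl_path 1 (\<lambda>_. b) t) \<subseteq> \<sigma>"
        using b by (intro bexI[of _ "{b}"]) simp_all
    qed
    ultimately show ?thesis
      using contract[OF N(1) loop] by (meson homotopic_with_trans)
  qed
  show ?thesis
    unfolding simply_connected_top_def
  proof (intro allI impI, elim conjE)
    fix p q assume "pathin (realization K) p" "p 1 = p 0" "pathin (realization K) q" "q 1 = q 0"
    then show "?H p q"
      using homotopic_with_trans[OF *[of p] homotopic_with_symD[OF *[of q]]] by simp
  qed
qed

text \<open>The index is taken modulo \<open>N\<close> so that a change at 0 also happens at
  \<open>N\<close> and the loop stays closed.\<close>

definition upd_loop :: "nat \<Rightarrow> (nat \<Rightarrow> 'a) \<Rightarrow> nat \<Rightarrow> 'a \<Rightarrow> nat \<Rightarrow> 'a" where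
  "upd_loop N w i y j = (if j mod N = i then y else w j)"

lemma contiguous_upd_loop:
  assumes K: "simplicial_cx K" and w: "vertex_loop K N w" and i: "i < N"
    and pre: "\<And>j. j < N \<Longrightarrow> Suc j mod N = i \<Longrightarrow> {w i, y, w j} \<in> K"
    and suc: "{w i, y, w (Suc i)} \<in> K"
  shows "contiguous K N w (upd_loop N w i y)"
proof -
  let ?w = "upd_loop N w i y"
  have w_mod: "w (Suc j) = w (Suc j mod N)" if "j < N" for j
    using w that by (cases "Suc j = N") (auto simp: vertex_loop_def)
  have *: "\<exists>\<sigma>\<in>K. {w j, w (Suc j), ?w j, ?w (Suc j)} \<subseteq> \<sigma>" if j: "j < N" for j
  proof (cases "Suc j mod N = i")
    case True
    then have "{w j, w (Suc j), ?w j, ?w (Suc j)} \<subseteq> {w i, y, w j}"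
      using w_mod[OF j] by (auto simp: upd_loop_def)
    with pre[OF j True] show ?thesis
      by blast
  next
    case neq: False
    show ?thesis
    proof (cases "j = i")
      case True
      then have "{w j, w (Suc j), ?w j, ?w (Suc j)} \<subseteq> {w i, y, w (Suc i)}"
        using neq by (auto simp: upd_loop_def)
      with suc show ?thesis
        by blast
    next
      case False
      then have "{w j, w (Suc j), ?w j, ?w (Suc j)} \<subseteq> {w j, w (Suc j)}"
        using neq j by (auto simp: upd_loop_def)
      moreover have "{w j, w (Suc j)} \<in> K"
        using w j by (simp add: vertex_loop_def)
      ultimately show ?thesis
        by blast
    qed
  qed
  moreover have "vertex_loop K N ?w"
    unfolding vertex_loop_def
  proof (intro conjI allI impI)
    show "?w N = ?w 0"
      using w i by (simp add: upd_loop_def vertex_loop_def)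
    fix j assume "j < N"
    then obtain \<sigma> where \<sigma>: "\<sigma> \<in> K" "{w j, w (Suc j), ?w j, ?w (Suc j)} \<subseteq> \<sigma>"
      using * by blast
    then show "{?w j, ?w (Suc j)} \<in> K"
      by (intro simplicial_cx_face[OF K \<sigma>(1)]) auto
  qed
  ultimately show ?thesis
    using w by (simp add: contiguous_def)
qed

lemma loop_predecessor:
  assumes "i < (N::nat)"
  obtains j where "j < N" "Suc j mod N = i" "\<And>k. k < N \<Longrightarrow> Suc k mod N = i \<Longrightarrow> k = j"
proof (cases i)
  case 0
  have "k = N - 1" if "k < N" "Suc k mod N = i" for k
    using that 0 by (cases "Suc k = N") auto
  moreover have "Suc (N - 1) mod N = i"
    using assms 0 by simp
  ultimately show ?thesis
    using that[of "N - 1"] assms by auto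
next
  case (Suc j)
  have "k = j" if "k < N" "Suc k mod N = i" for k
    using that Suc by (cases "Suc k = N") auto
  moreover have "j < N" "Suc j mod N = i"
    using assms Suc by simp_all
  ultimately show ?thesis
    using that by blast
qed

section \<open>Four-cycles and the coned complex of a square complex\<close>

lemma cycle_edges_image:
  "cycle_edges c = (\<lambda>i. {c ! i, c ! (Suc i mod length c)}) ` {..<length c}"
  unfolding cycle_edges_def by blast

lemma cycle_edges_4: "cycle_edges [a, b, c, d] = {{a, b}, {b, c}, {c, d}, {d, a}}"
proof -
  let ?l = "[a, b, c, d]"
  have "cycle_edges ?l = (\<lambda>i. {?l ! i, ?l ! (Suc i mod length ?l)}) ` {..<length ?l}"
    by (rule cycle_edges_image)
  also have "{..<length ?l} = {0, Suc 0, Suc (Suc 0), Suc (Suc (Suc 0))}"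
    by auto
  finally show ?thesis
    by simp
qed

lemma four_cyclesE:
  assumes "q \<in> four_cycles G"
  obtains a b c d where "q = {{a, b}, {b, c}, {c, d}, {d, a}}" "distinct [a, b, c, d]"
    "{a, b, c, d} \<subseteq> verts G" "q \<subseteq> edges G"
proof -
  obtain l where l: "q = cycle_edges l" "embedded_cycle G l" "length l = 4"
    using assms by (auto simp: four_cycles_def)
  then obtain a b c d where abcd: "l = [a, b, c, d]"
    by (auto simp: length_Suc_conv eval_nat_numeral)
  show ?thesis
    using l(1,2) unfolding embedded_cycle_def abcd cycle_edges_4 by (intro that[of a b c d]) simp_all
qed

lemma cycle_edges_4_in_four_cycles:
  "cycle_edges [a, b, c, d] \<in> four_cycles G" if "distinct [a, b, c, d]"
  "{a, b, c, d} \<subseteq> verts G" "{{a, b}, {b, c}, {c, d}, {d, a}} \<subseteq> edges G"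
  unfolding four_cycles_def embedded_cycle_def using that
  by (intro CollectI exI[of _ "[a, b, c, d]"]) (simp add: cycle_edges_4)

text \<open>A 4-cycle has diameter 2. This is used to move a loop off the apex of a square: the two
  neighbours of the apex in the loop are joined through \<open>v\<close> instead.\<close>

lemma four_cycle_common_neighbour:
  assumes "q \<in> four_cycles G" "x \<in> \<Union>q" "y \<in> \<Union>q"
  shows "\<exists>v\<in>\<Union>q. (x = v \<or> {x, v} \<in> q) \<and> (y = v \<or> {y, v} \<in> q)"
proof -
  obtain a b c d where q: "q = {{a, b}, {b, c}, {c, d}, {d, a}}"
    using assms(1) by (rule four_cyclesE)
  have "\<Union>q = {a, b, c, d}"
    unfolding q by blast
  with assms(2,3) consider "y = x" | "x \<in> {a, c}" "y \<in> {b, d}" | "x \<in> {b, d}" "y \<in> {a, c}"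
    | "x \<in> {a, c}" "y \<in> {a, c}" | "x \<in> {b, d}" "y \<in> {b, d}"
    by blast
  then show ?thesis
  proof cases
    case 1
    then show ?thesis
      using assms(2) by blast
  next
    case 2
    then show ?thesis
      unfolding q by (intro bexI[of _ x]) (auto simp: insert_commute)
  next
    case 3
    then show ?thesis
      unfolding q by (intro bexI[of _ x]) (auto simp: insert_commute)
  next
    case 4
    then show ?thesis
      unfolding q by (intro bexI[of _ b]) (auto simp: insert_commute)
  next
    case 5
    then show ?thesis
      unfolding q by (intro bexI[of _ c]) (auto simp: insert_commute)
  qed
qed

locale square_cx =
  fixes X :: "'v square_cx"
  assumes X: "square_complex X"
begin

lemma edge_card: "e \<in> edges X \<Longrightarrow> e \<subseteq> verts X \<and> card e = 2"
  using X unfolding square_complex_def simplicial_graph_def by blast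

lemma square_four_cycle: "q \<in> squares X \<Longrightarrow> q \<in> four_cycles X"
  using X unfolding square_complex_def by blast

lemma square_edges: "q \<in> squares X \<Longrightarrow> q \<subseteq> edges X"
  by (drule square_four_cycle) (erule four_cyclesE)

lemma square_nonempty:
  assumes "q \<in> squares X"
  shows "\<Union>q \<noteq> {}"
proof -
  obtain a b c d where "q = {{a, b}, {b, c}, {c, d}, {d, a}}"
    using square_four_cycle[OF assms] by (rule four_cyclesE)
  then show ?thesis
    by simp
qed

lemma coned_cx_cases:
  assumes "s \<in> coned_cx X"
  obtains v where "s = {Inl v}" "v \<in> verts X" | e where "s = Inl ` e" "e \<in> edges X"
    | q where "s = {Inr q}" "q \<in> squares X"
    | q v where "s = {Inr q, Inl v}" "q \<in> squares X" "v \<in> \<Union>q"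
    | q e where "s = insert (Inr q) (Inl ` e)" "q \<in> squares X" "e \<in> q"
  using assms unfolding coned_cx_def Un_iff mem_Collect_eq
  by (elim disjE exE conjE) (rule that; assumption)+

lemma coned_cxI:
  "v \<in> verts X \<Longrightarrow> {Inl v} \<in> coned_cx X"
  "e \<in> edges X \<Longrightarrow> Inl ` e \<in> coned_cx X"
  "q \<in> squares X \<Longrightarrow> {Inr q} \<in> coned_cx X"
  "q \<in> squares X \<Longrightarrow> v \<in> \<Union>q \<Longrightarrow> {Inr q, Inl v} \<in> coned_cx X"
  "q \<in> squares X \<Longrightarrow> e \<in> q \<Longrightarrow> insert (Inr q) (Inl ` e) \<in> coned_cx X"
  unfolding coned_cx_def
  subgoal by (rule UnI1, rule UnI1, rule UnI1, rule UnI1, rule CollectI) iprover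
  subgoal by (rule UnI1, rule UnI1, rule UnI1, rule UnI2, rule CollectI) iprover
  subgoal by (rule UnI1, rule UnI1, rule UnI2, rule CollectI) iprover
  subgoal by (rule UnI1, rule UnI2, rule CollectI) iprover
  subgoal by (rule UnI2, rule CollectI) iprover
  done

lemma edge_faces:
  assumes "e \<in> edges X" "f \<subseteq> e" "f \<noteq> {}"
  shows "f = e \<or> (\<exists>v\<in>e. f = {v})"
proof -
  obtain x y where "e = {x, y}"
    using edge_card[OF assms(1)] by (meson card_2_iff)
  with assms(2,3) show ?thesis
    by blast
qed

lemma simplicial_coned_cx: "simplicial_cx (coned_cx X)"
  unfolding simplicial_cx_def
proof (intro conjI ballI allI impI)
  fix s assume s: "s \<in> coned_cx X"
  have fin: "finite e \<and> e \<noteq> {}" if "e \<in> edges X" for e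
    using edge_card[OF that] by (metis card.empty card.infinite zero_neq_numeral)
  from s show "finite s" "s \<noteq> {}"
    by (cases rule: coned_cx_cases; use fin square_edges in auto)+
next
  fix s t assume s: "s \<in> coned_cx X" and "t \<subseteq> s \<and> t \<noteq> {}"
  then have t: "t \<subseteq> s" "t \<noteq> {}"
    by blast+
  have edge: "Inl ` f \<in> coned_cx X" if e: "e \<in> edges X" "f \<subseteq> e" "f \<noteq> {}" for e f
  proof -
    consider "f = e" | v where "v \<in> e" "f = {v}"
      using edge_faces[OF e] by blast
    then show ?thesis
      using e(1) edge_card[OF e(1)] coned_cxI(1,2) by cases auto
  qed
  from s show "t \<in> coned_cx X"
  proof (cases rule: coned_cx_cases)
    case (1 v)
    then have "t = {Inl v}"
      using t by blast
    then show ?thesis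
      using 1 s by simp
  next
    case (2 e)
    then obtain f where "t = Inl ` f" "f \<subseteq> e"
      using t(1) subset_imageE by metis
    then show ?thesis
      using edge[OF 2(2)] t(2) by blast
  next
    case (3 q)
    then have "t = {Inr q}"
      using t by blast
    then show ?thesis
      using 3 s by simp
  next
    case (4 q v)
    then have "t = {Inr q} \<or> t = {Inl v} \<or> t = {Inr q, Inl v}"
      using t by blast
    moreover have "v \<in> verts X"
      using 4 square_edges edge_card by blast
    ultimately show ?thesis
      using 4 coned_cxI by blast
  next
    case (5 q e)
    have e: "e \<in> edges X"
      using 5 square_edges by blast
    have "t - {Inr q} \<subseteq> Inl ` e"
      using t(1) 5(1) by blast
    then obtain f where f: "t - {Inr q} = Inl ` f" "f \<subseteq> e"
      using subset_imageE by metis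
    show ?thesis
    proof (cases "Inr q \<in> t")
      case False
      then show ?thesis
        using f edge[OF e f(2)] t(2) by auto
    next
      case True
      then have tq: "t = insert (Inr q) (Inl ` f)"
        using f(1) by blast
      consider "f = {}" | "f = e" | v where "v \<in> e" "f = {v}"
        using edge_faces[OF e f(2)] by blast
      then show ?thesis
      proof cases
        case 1
        then show ?thesis
          using coned_cxI(3) 5 by (simp add: tq)
      next
        case 2
        then show ?thesis
          using coned_cxI(5) 5 by (simp add: tq)
      next
        case (3 v)
        then have "v \<in> \<Union>q"
          using 5 by blast
        then show ?thesis
          using coned_cxI(4)[OF 5(2)] 3 by (simp add: tq)
      qed
    qed
  qed
qed

lemma coned_cx_Inl_Inl:
  assumes "{Inl x, Inl y} \<in> coned_cx X" "x \<noteq> y"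
  shows "{x, y} \<in> edges X"
  using assms(1)
proof (cases rule: coned_cx_cases)
  case (2 e)
  have "{x, y} = Inl -` {Inl x, Inl y :: 'v + 'v set set}"
    by auto
  also have "\<dots> = e"
    unfolding 2(1) by auto
  finally show ?thesis
    using 2(2) by simp
qed (use assms(2) in \<open>auto simp: doubleton_eq_iff\<close>)

lemma coned_cx_Inr:
  assumes "{Inr q, z} \<in> coned_cx X"
  shows "q \<in> squares X \<and> (z = Inr q \<or> (\<exists>v\<in>\<Union>q. z = Inl v))"
  using assms
proof (cases rule: coned_cx_cases)
  case (5 q' e)
  have "q' = q"
    using 5(1) by (metis Inl_Inr_False image_iff insertE insertI1 sum.inject(2))
  moreover have "z \<in> insert (Inr q) (Inl ` e)"
    using 5(1) \<open>q' = q\<close> by blast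
  ultimately show ?thesis
    using 5 by blast
next
  case (2 e)
  then show ?thesis
    by (metis Inl_Inr_False image_iff insertI1)
qed (auto simp: doubleton_eq_iff)

text \<open>An apex is adjacent only to the corners of its own square. It is therefore replaced by a
  corner that is equal or adjacent to both of its neighbours in the loop, and the number of apexes
  drops.\<close>

lemma apex_free_loop:
  assumes "vertex_loop (coned_cx X) N w"
  shows "\<exists>x. (contiguous (coned_cx X) N)\<^sup>*\<^sup>* w (Inl \<circ> x) \<and> vertex_loop (coned_cx X) N (Inl \<circ> x)"
  using assms
proof (induction "card {i. i < N \<and> \<not> isl (w i)}" arbitrary: w rule: less_induct)
  case less
  let ?A = "\<lambda>w. {i. i < N \<and> \<not> isl (w i)}" and ?K = "coned_cx X"
  have fin: "finite (?A w)" for w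
    by simp
  show ?case
  proof (cases "N = 0 \<or> ?A w = {}")
    case True
    define x where "x i = projl (w i)" for i
    show ?thesis
    proof (cases "N = 0")
      case True
      then have "contiguous ?K N w (Inl \<circ> x)"
        by (simp add: contiguous_def vertex_loop_def)
      then show ?thesis
        using contiguous_def by blast
    next
      case False
      with True have "isl (w i)" if "i < N" for i
        using that by blast
      moreover have wN: "w N = w 0"
        using less.prems by (simp add: vertex_loop_def)
      ultimately have eq: "(Inl \<circ> x) i = w i" if "i \<le> N" for i
        using that False by (cases "i = N") (auto simp: x_def)
      have "vertex_loop ?K N (Inl \<circ> x)"
        using less.prems eq by (simp add: vertex_loop_def del: o_apply)
      moreover have "contiguous ?K N w (Inl \<circ> x)"
        unfolding contiguous_def
      proof (intro conjI less.prems calculation allI impI)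
        fix i assume "i < N"
        then show "\<exists>\<sigma>\<in>?K. {w i, w (Suc i), (Inl \<circ> x) i, (Inl \<circ> x) (Suc i)} \<subseteq> \<sigma>"
          using less.prems eq[of i] eq[of "Suc i"]
          by (intro bexI[of _ "{w i, w (Suc i)}"]) (simp_all add: vertex_loop_def)
      qed
      ultimately show ?thesis
        by blast
    qed
  next
    case False
    then obtain i q where i: "i < N" "w i = Inr q"
      by (auto simp: isl_def) (metis sum.exhaust_sel)
    obtain j where j: "j < N" "Suc j mod N = i" "\<And>k. k < N \<Longrightarrow> Suc k mod N = i \<Longrightarrow> k = j"
      using loop_predecessor[OF i(1)] by metis
    have "w (Suc j) = w i"
      using less.prems j(1,2) by (cases "Suc j = N") (auto simp: vertex_loop_def)
    then have "{Inr q, w j} \<in> ?K" "{Inr q, w (Suc i)} \<in> ?K"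
      using less.prems i j(1) by (auto simp: vertex_loop_def insert_commute)
    note nbr = this[THEN coned_cx_Inr]
    then have q: "q \<in> squares X" by blast
    \<comment> \<open>A neighbour in the loop may be the same apex once more; it then imposes no
      condition on \<open>v\<close>, whence the implications.\<close>
    have "\<exists>v\<in>\<Union>q. (\<forall>a. w j = Inl a \<longrightarrow> a = v \<or> {a, v} \<in> q) \<and>
        (\<forall>a. w (Suc i) = Inl a \<longrightarrow> a = v \<or> {a, v} \<in> q)"
    proof -
      obtain a0 where a0: "a0 \<in> \<Union>q"
        using square_nonempty[OF q] by blast
      obtain x where "x \<in> \<Union>q" "\<forall>a. w j = Inl a \<longrightarrow> a = x"
        using nbr(1) a0 by (cases "w j") auto
      moreover obtain y where "y \<in> \<Union>q" "\<forall>a. w (Suc i) = Inl a \<longrightarrow> a = y"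
        using nbr(2) a0 by (cases "w (Suc i)") auto
      ultimately show ?thesis
        using four_cycle_common_neighbour[OF square_four_cycle[OF q], of x y] by blast
    qed
    then obtain v where v: "v \<in> \<Union>q" "\<And>a. w j = Inl a \<Longrightarrow> a = v \<or> {a, v} \<in> q"
      "\<And>a. w (Suc i) = Inl a \<Longrightarrow> a = v \<or> {a, v} \<in> q"
      by blast
    have simplex: "{Inr q, Inl v, z} \<in> ?K"
      if z: "z = Inr q \<or> (\<exists>u\<in>\<Union>q. z = Inl u)" "\<forall>a. z = Inl a \<longrightarrow> a = v \<or> {a, v} \<in> q" for z
    proof -
      consider "z = Inr q" | "z = Inl v" | a where "z = Inl a" "{a, v} \<in> q"
        using z by blast
      then show ?thesis
      proof cases
        case (3 a)
        have "{Inr q, Inl v, z} = insert (Inr q) (Inl ` {a, v})"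
          by (auto simp: 3)
        with coned_cxI(5)[OF q 3(2)] show ?thesis
          by simp
      qed (use coned_cxI(4)[OF q v(1)] in \<open>simp_all add: insert_commute\<close>)
    qed
    let ?w = "upd_loop N w i (Inl v)"
    have c: "contiguous ?K N w ?w"
    proof (rule contiguous_upd_loop[OF simplicial_coned_cx less.prems i(1)])
      show "{w i, Inl v, w (Suc i)} \<in> ?K"
        unfolding i(2) using nbr(2) v(3) by (intro simplex allI impI) blast+
      fix k assume "k < N" "Suc k mod N = i"
      then have "k = j"
        by (rule j(3))
      then show "{w i, Inl v, w k} \<in> ?K"
        unfolding i(2) using nbr(1) v(2) by (intro simplex allI impI) blast+
    qed
    have "?A ?w = ?A w - {i}"
      by (auto simp: upd_loop_def split: if_splits)
    moreover have "i \<in> ?A w"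
      using i by simp
    ultimately have "card (?A ?w) < card (?A w)"
      using fin by (metis card_Diff1_less)
    then obtain x where "(contiguous ?K N)\<^sup>*\<^sup>* ?w (Inl \<circ> x)" "vertex_loop ?K N (Inl \<circ> x)"
      using less.hyps[of ?w] c unfolding contiguous_def by blast
    then show ?thesis
      using c by (meson converse_rtranclp_into_rtranclp)
  qed
qed

text \<open>A combinatorial Morse argument. \<open>descend\<close> excludes local minima other than
  \<open>b\<close>, and \<open>squeeze\<close> joins any two descending edges by a square whose
  fourth corner is lower too, so that a peak of a loop can be pushed across it.\<close>

context
  fixes lv :: "'v \<Rightarrow> nat" and b :: 'v
  assumes lv_edge: "\<And>x y. {x, y} \<in> edges X \<Longrightarrow> lv x \<noteq> lv y"
    and b: "b \<in> verts X"
    and descend: "\<And>v. v \<in> verts X \<Longrightarrow> v \<noteq> b \<Longrightarrow> \<exists>y. {v, y} \<in> edges X \<and> lv y < lv v"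
    and squeeze: "\<And>v x y. {v, x} \<in> edges X \<Longrightarrow> {v, y} \<in> edges X \<Longrightarrow> lv x < lv v \<Longrightarrow> lv y < lv v \<Longrightarrow>
      x \<noteq> y \<Longrightarrow> \<exists>u. lv u < lv v \<and> cycle_edges [v, x, u, y] \<in> squares X"
begin

lemma contract_loop_step:
  assumes N: "0 < N" and x: "vertex_loop (coned_cx X) N (Inl \<circ> x)"
    and nb: "\<not> (\<forall>i<N. x i = b)"
  shows "\<exists>x'. (contiguous (coned_cx X) N)\<^sup>*\<^sup>* (Inl \<circ> x) (Inl \<circ> x') \<and>
    vertex_loop (coned_cx X) N (Inl \<circ> x') \<and> (\<Sum>i<N. lv (x' i)) < (\<Sum>i<N. lv (x i))"
proof -
  let ?K = "coned_cx X"
  have xN: "x N = x 0"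
    using x by (simp add: vertex_loop_def)
  have seg: "{Inl (x i), Inl (x (Suc i))} \<in> ?K" if "i < N" for i
    using x that by (simp add: vertex_loop_def)
  have edge: "{x i, x (Suc i)} \<in> edges X" if "i < N" "x i \<noteq> x (Suc i)" for i
    using coned_cx_Inl_Inl[OF seg] that by blast
  show ?thesis
  \<comment> \<open>A constant loop has no peak with a lower successor, so it is moved down as a
    whole; every other loop is changed at a single index.\<close>
  proof (cases "\<forall>i<N. x i = x 0")
    case True
    have "{Inl (x 0)} \<in> ?K"
      using simplicial_cx_face[OF simplicial_coned_cx seg[OF N], of "{Inl (x 0)}"] by simp
    then have "x 0 \<in> verts X"
    proof (cases rule: coned_cx_cases)
      case (2 e)
      then have "x 0 \<in> e"
        by (metis Inl_inject image_iff singletonI)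
      then show ?thesis
        using edge_card[OF 2(2)] by blast
    qed auto
    moreover have "x 0 \<noteq> b"
      using True nb by metis
    ultimately obtain y where y: "{x 0, y} \<in> edges X" "lv y < lv (x 0)"
      using descend by blast
    have xy: "{Inl (x 0), Inl y} \<in> ?K"
      using coned_cxI(2)[OF y(1)] by simp
    let ?x = "\<lambda>_::nat. y"
    have "{Inl y} \<in> ?K"
      using simplicial_cx_face[OF simplicial_coned_cx xy, of "{Inl y}"] by simp
    then have loop: "vertex_loop ?K N (Inl \<circ> ?x)"
      by (simp add: vertex_loop_def)
    have const: "x i = x 0" if "i \<le> N" for i
    proof (cases "i = N")
      case False
      then have "i < N"
        using that by simp
      with True show ?thesis
        by blast
    qed (use xN in simp)
    have "contiguous ?K N (Inl \<circ> x) (Inl \<circ> ?x)"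
      unfolding contiguous_def
    proof (intro conjI x loop allI impI)
      fix i assume "i < N"
      then have "x i = x 0" "x (Suc i) = x 0"
        using const[of i] const[of "Suc i"] by simp_all
      then show "\<exists>\<sigma>\<in>?K. {(Inl \<circ> x) i, (Inl \<circ> x) (Suc i), (Inl \<circ> ?x) i, (Inl \<circ> ?x) (Suc i)} \<subseteq> \<sigma>"
        using xy by (intro bexI[of _ "{Inl (x 0), Inl y}"]) simp_all
    qed
    moreover have "(\<Sum>i<N. lv (?x i)) < (\<Sum>i<N. lv (x i))"
    proof (rule sum_strict_mono)
      fix i assume "i \<in> {..<N}"
      then have "x i = x 0"
        by (intro const) simp
      with y(2) show "lv (?x i) < lv (x i)"
        by simp
    qed (use N in auto)
    ultimately show ?thesis
      using loop by blast
  next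
    case False
    define n where "n = Max ((\<lambda>i. lv (x i)) ` {..<N})"
    have le_n: "lv (x i) \<le> n" if "i \<le> N" for i
    proof -
      have "lv (x i) \<in> (\<lambda>i. lv (x i)) ` {..<N}"
        using that N xN by (cases "i = N") auto
      then show ?thesis
        unfolding n_def by simp
    qed
    have "n \<in> (\<lambda>i. lv (x i)) ` {..<N}"
      unfolding n_def using N by (intro Max_in) auto
    then obtain i0 where i0: "i0 < N" "lv (x i0) = n"
      by auto
    \<comment> \<open>The end of a run at the top level. Without one, the run from \<open>i0\<close>
      would reach index \<open>N\<close>, which is index 0 again, and the loop would be
      constant.\<close>
    have "\<exists>i<N. lv (x i) = n \<and> x (Suc i) \<noteq> x i"
    proof (rule ccontr)
      assume "\<not> ?thesis"
      then have stay: "x (Suc i) = x i" if "i < N" "lv (x i) = n" for i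
        using that by blast
      have run: "x (k + j) = x k" if "k + j \<le> N" "lv (x k) = n" for k j
        using that by (induction j) (simp_all add: stay)
      have "x (i0 + (N - i0)) = x i0"
        by (rule run) (use i0 in simp_all)
      then have "x 0 = x i0"
        using i0(1) xN by simp
      then have "x j = x 0" if "j < N" for j
        using run[of 0 j] that i0(2) by simp
      with False show False
        by blast
    qed
    then obtain i where i: "i < N" "lv (x i) = n" "x (Suc i) \<noteq> x i"
      by blast
    define v s where "v = x i" and "s = x (Suc i)"
    have vs: "{v, s} \<in> edges X" "lv s < lv v" "s \<noteq> v"
      using edge[OF i(1)] i le_n[of "Suc i"] lv_edge[of v s] by (auto simp: v_def s_def)
    obtain j where j: "j < N" "Suc j mod N = i" "\<And>k. k < N \<Longrightarrow> Suc k mod N = i \<Longrightarrow> k = j"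
      using loop_predecessor[OF i(1)] by metis
    define p where "p = x j"
    have xj: "x (Suc j) = v"
      using j(1,2) xN by (cases "Suc j = N") (auto simp: v_def)
    have p: "p = v \<or> {v, p} \<in> edges X \<and> lv p < lv v"
      using edge[OF j(1)] xj le_n[of j] j(1) lv_edge[of v p] i(2)
      by (auto simp: p_def v_def insert_commute)
    have N1: "N \<noteq> 1"
      using i xN by auto
    have drop: "(\<Sum>k<N. lv (upd_loop N x i u k)) < (\<Sum>k<N. lv (x k))" if "lv u < lv v" for u
    proof (rule sum_strict_mono_ex1)
      show "\<forall>k\<in>{..<N}. lv (upd_loop N x i u k) \<le> lv (x k)"
        using that by (auto simp: upd_loop_def v_def)
      show "\<exists>k\<in>{..<N}. lv (upd_loop N x i u k) < lv (x k)"
        using that i(1) by (intro bexI[of _ i]) (auto simp: upd_loop_def v_def)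
    qed simp
    have Inl_upd: "upd_loop N (Inl \<circ> x) i (Inl u) = Inl \<circ> upd_loop N x i u" for u
      by (auto simp: upd_loop_def)
    have K: "{Inl v, Inl s} \<in> ?K"
      using coned_cxI(2)[OF vs(1)] by simp
    show ?thesis
    \<comment> \<open>A repeated vertex or a backtrack: the edge from \<open>v\<close> to
      \<open>s\<close> alone allows \<open>v\<close> to be replaced by \<open>s\<close>.\<close>
    proof (cases "p = v \<or> p = s")
      case True
      have "contiguous ?K N (Inl \<circ> x) (upd_loop N (Inl \<circ> x) i (Inl s))"
      proof (rule contiguous_upd_loop[OF simplicial_coned_cx x i(1)])
        show "{(Inl \<circ> x) i, Inl s, (Inl \<circ> x) (Suc i)} \<in> ?K"
          using K by (simp flip: v_def s_def)
        fix k assume "k < N" "Suc k mod N = i"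
        then have "x k = p"
          using j(3) by (simp add: p_def)
        then show "{(Inl \<circ> x) i, Inl s, (Inl \<circ> x) k} \<in> ?K"
          using K True by (auto simp: insert_commute simp flip: v_def)
      qed
      then show ?thesis
        using drop[OF vs(2)] unfolding Inl_upd by (meson contiguous_def r_into_rtranclp)
    next
      case False
      then have p: "{v, p} \<in> edges X" "lv p < lv v" "p \<noteq> s"
        using p by auto
      obtain u where u: "lv u < lv v" "cycle_edges [v, s, u, p] \<in> squares X"
        using squeeze[OF vs(1) p(1) vs(2) p(2)] p(3) by metis
      define q where "q = {{v, s}, {s, u}, {u, p}, {p, v}}"
      have q: "q \<in> squares X"
        using u(2) by (simp add: cycle_edges_4 q_def)
      have simplex: "insert (Inr q) (Inl ` e) \<in> ?K" if "e \<in> q" for e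
        using coned_cxI(5)[OF q that] .
      \<comment> \<open>No simplex contains \<open>v\<close>, \<open>s\<close> and \<open>u\<close>
        together, so the move from \<open>v\<close> to \<open>u\<close> takes two contiguities, with
        the apex of the square in between.\<close>
      let ?w = "upd_loop N (Inl \<circ> x) i (Inr q)"
      have c1: "contiguous ?K N (Inl \<circ> x) ?w"
      proof (rule contiguous_upd_loop[OF simplicial_coned_cx x i(1)])
        show "{(Inl \<circ> x) i, Inr q, (Inl \<circ> x) (Suc i)} \<in> ?K"
          using simplex[of "{v, s}"] by (simp add: q_def insert_commute flip: v_def s_def)
        fix k assume "k < N" "Suc k mod N = i"
        then have "x k = p"
          using j(3) by (simp add: p_def)
        then show "{(Inl \<circ> x) i, Inr q, (Inl \<circ> x) k} \<in> ?K"
          using simplex[of "{p, v}"] by (simp add: q_def insert_commute flip: v_def)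
      qed
      have "Suc i mod N \<noteq> i"
        using i(1) N1 by (cases "Suc i = N") auto
      then have ws: "?w i = Inr q" "?w (Suc i) = Inl s"
        using i(1) by (simp_all add: upd_loop_def s_def)
      have "upd_loop N ?w i (Inl u) = Inl \<circ> upd_loop N x i u"
        by (auto simp: upd_loop_def)
      moreover have "contiguous ?K N ?w (upd_loop N ?w i (Inl u))"
      proof (rule contiguous_upd_loop[OF simplicial_coned_cx _ i(1)])
        show "vertex_loop ?K N ?w"
          using c1 by (simp add: contiguous_def)
        show "{?w i, Inl u, ?w (Suc i)} \<in> ?K"
          unfolding ws using simplex[of "{s, u}"] by (simp add: q_def insert_commute)
        fix k assume k: "k < N" "Suc k mod N = i"
        then have "k = j"
          by (rule j(3))
        moreover have "k \<noteq> i"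
          using k \<open>Suc i mod N \<noteq> i\<close> by blast
        ultimately have "?w k = Inl p"
          using k(1) by (simp add: upd_loop_def p_def)
        then show "{?w i, Inl u, ?w k} \<in> ?K"
          using simplex[of "{u, p}"] ws(1) by (simp add: q_def insert_commute)
      qed
      ultimately have c2: "contiguous ?K N ?w (Inl \<circ> upd_loop N x i u)"
        by simp
      then have "vertex_loop ?K N (Inl \<circ> upd_loop N x i u)"
        by (simp add: contiguous_def)
      moreover have "(contiguous ?K N)\<^sup>*\<^sup>* (Inl \<circ> x) (Inl \<circ> upd_loop N x i u)"
        using c1 c2 by (meson converse_rtranclp_into_rtranclp r_into_rtranclp)
      ultimately show ?thesis
        using drop[OF u(1)] by blast
    qed
  qed
qed

lemma contract_loop:
  assumes N: "0 < N"
  shows "vertex_loop (coned_cx X) N (Inl \<circ> x) \<Longrightarrow>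
    (contiguous (coned_cx X) N)\<^sup>*\<^sup>* (Inl \<circ> x) (\<lambda>_. Inl b)"
proof (induction "\<Sum>i<N. lv (x i)" arbitrary: x rule: less_induct)
  case less
  show ?case
  proof (cases "\<forall>i<N. x i = b")
    case True
    have const: "x i = b" if "i \<le> N" for i
      using True less.prems N that by (cases "i = N") (auto simp: vertex_loop_def)
    have bK: "{Inl b} \<in> coned_cx X"
      using b by (rule coned_cxI)
    have "contiguous (coned_cx X) N (Inl \<circ> x) (\<lambda>_. Inl b)"
      unfolding contiguous_def
    proof (intro conjI less.prems allI impI)
      show "vertex_loop (coned_cx X) N (\<lambda>_. Inl b)"
        using bK by (simp add: vertex_loop_def)
      fix i assume "i < N"
      then show "\<exists>\<sigma>\<in>coned_cx X. {(Inl \<circ> x) i, (Inl \<circ> x) (Suc i), Inl b, Inl b} \<subseteq> \<sigma>"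
        using bK const[of i] const[of "Suc i"] by (intro bexI[of _ "{Inl b}"]) simp_all
    qed
    then show ?thesis
      by blast
  next
    case False
    obtain x' where "(contiguous (coned_cx X) N)\<^sup>*\<^sup>* (Inl \<circ> x) (Inl \<circ> x')"
      "vertex_loop (coned_cx X) N (Inl \<circ> x')" "(\<Sum>i<N. lv (x' i)) < (\<Sum>i<N. lv (x i))"
      using contract_loop_step[OF N less.prems False] by metis
    then show ?thesis
      using less.hyps[of x'] by (meson rtranclp_trans)
  qed
qed

theorem simply_connected_square_realization: "simply_connected_top (square_realization X)"
  unfolding square_realization_def
proof (rule simply_connected_topI[OF simplicial_coned_cx])
  show "{Inl b} \<in> coned_cx X"
    using b by (rule coned_cxI)
  fix N w assume "0 < N" "vertex_loop (coned_cx X) N w"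
  then show "(contiguous (coned_cx X) N)\<^sup>*\<^sup>* w (\<lambda>_. Inl b)"
    using apex_free_loop contract_loop by (metis rtranclp_trans)
qed

end
end

section \<open>Complexes whose links have girth at least 6\<close>

definition tri :: "'v set set \<Rightarrow> 'v \<Rightarrow> 'v \<Rightarrow> 'v \<Rightarrow> bool" where
  "tri K u v w \<longleftrightarrow> {u, v, w} \<in> K \<and> u \<noteq> v \<and> v \<noteq> w \<and> u \<noteq> w"

lemma tri_commute: "tri K u v w \<longleftrightarrow> tri K v u w" "tri K u v w \<longleftrightarrow> tri K u w v"
  by (auto simp: tri_def insert_commute)

lemma tri_neq: "tri K u v w \<Longrightarrow> u \<noteq> v \<and> v \<noteq> w \<and> u \<noteq> w"
  by (simp add: tri_def)

text \<open>
  A vertex of the universal cover is given by its image \<open>lab\<close> and the partial map \<open>low\<close>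
  sending the images of its neighbours closer to the base vertex to these neighbours.
  The function \<open>step K s x\<close> lifts the edge from \<open>lab s\<close> to \<open>x\<close>: it goes to a lower
  neighbour if there is one over \<open>x\<close>; otherwise, if some lower neighbour over \<open>u\<close> spans
  a triangle \<open>u\<close>, \<open>lab s\<close>, \<open>x\<close>, it goes horizontally, to the lift at that lower neighbour;
  otherwise it goes up, to a vertex whose lower neighbours are \<open>s\<close> and the horizontal
  neighbours of \<open>s\<close> spanning a triangle with \<open>s\<close> and \<open>x\<close>.
\<close>

datatype 'v cover_vertex = Nd (lab: 'v) (low: "'v \<Rightarrow> 'v cover_vertex option")

definition via :: "'v set set \<Rightarrow> 'v cover_vertex \<Rightarrow> 'v \<Rightarrow> 'v \<Rightarrow> bool" where
  "via K s x u \<longleftrightarrow> u \<in> dom (low s) \<and> tri K u (lab s) x"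

definition hor :: "'v set set \<Rightarrow> 'v cover_vertex \<Rightarrow> 'v \<Rightarrow> bool" where
  "hor K s x \<longleftrightarrow> x \<notin> dom (low s) \<and> (\<exists>u. via K s x u)"

definition up :: "'v set set \<Rightarrow> 'v cover_vertex \<Rightarrow> 'v \<Rightarrow> bool" where
  "up K s x \<longleftrightarrow> {lab s, x} \<in> K \<and> x \<noteq> lab s \<and> x \<notin> dom (low s) \<and> (\<nexists>u. via K s x u)"

primrec step :: "'v set set \<Rightarrow> 'v cover_vertex \<Rightarrow> 'v \<Rightarrow> 'v cover_vertex" where
  "step K (Nd v D) =
     (let R = (\<lambda>u. map_option (step K) (D u));
          s = Nd v D;
          h = (\<lambda>x. the (R (SOME u. via K s x u)) x)
      in (\<lambda>x. if x = v then s
           else (case D x of Some d \<Rightarrow> d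
           | None \<Rightarrow> if \<exists>u. via K s x u then h x
             else Nd x (\<lambda>y. if y = v then Some s
                            else if hor K s y \<and> tri K v y x then Some (h y) else None))))"

lemma step_lab [simp]: "step K s (lab s) = s"
  by (cases s) (simp add: Let_def)

lemma step_low: "low s x = Some d \<Longrightarrow> x \<noteq> lab s \<Longrightarrow> step K s x = d"
  by (cases s) (simp add: Let_def)

lemma horE:
  assumes "hor K s x"
  obtains u d where "low s u = Some d" "tri K u (lab s) x"
  using assms by (auto simp: hor_def via_def)

lemma step_hor_choice:
  "hor K s x \<Longrightarrow> step K s x = the (map_option (step K) (low s (SOME u. via K s x u))) x"
  by (cases s) (auto simp: hor_def via_def tri_def Let_def domIff)

text \<open>The lower neighbour used by \<open>step\<close> is picked by \<open>SOME\<close>, so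
  here only the existence of a suitable one is known. \<open>hor_step\<close> extends the equation
  to every lower neighbour of this kind.\<close>

lemma step_hor:
  assumes "hor K s x"
  shows "\<exists>u d. low s u = Some d \<and> tri K u (lab s) x \<and> step K s x = step K d x"
proof -
  let ?u = "SOME u. via K s x u"
  have "via K s x ?u"
    using assms unfolding hor_def by (metis someI)
  then obtain d where "low s ?u = Some d" "tri K ?u (lab s) x"
    by (auto simp only: via_def dom_def)
  with step_hor_choice[OF assms] show ?thesis
    by (metis option.map_sel option.sel option.simps(3))
qed

lemma step_up:
  assumes "up K s x"
  shows "step K s x =
    Nd x (\<lambda>y. if y = lab s then Some s
               else if hor K s y \<and> tri K (lab s) y x then Some (step K s y) else None)"
proof -
  let ?h = "\<lambda>y. the (map_option (step K) (low s (SOME u. via K s y u))) y"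
  have "step K s x =
    Nd x (\<lambda>y. if y = lab s then Some s
               else if hor K s y \<and> tri K (lab s) y x then Some (?h y) else None)"
    using assms by (cases s) (auto simp: up_def Let_def domIff)
  also have "\<dots> =
    Nd x (\<lambda>y. if y = lab s then Some s
               else if hor K s y \<and> tri K (lab s) y x then Some (step K s y) else None)"
    using step_hor_choice[of K s] by (simp add: fun_eq_iff)
  finally show ?thesis .
qed

lemma lab_step_up: "up K s x \<Longrightarrow> lab (step K s x) = x"
  by (simp add: step_up)

lemma low_step_up:
  "up K s x \<Longrightarrow> low (step K s x) y =
     (if y = lab s then Some s
      else if hor K s y \<and> tri K (lab s) y x then Some (step K s y) else None)"
  by (simp add: step_up)

text \<open>Only upward steps create vertices. A vertex that can be reached from two vertices below
  is created twice as the same datum, by \<open>hor_up\<close>, so no quotient has to be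
  taken.\<close>

inductive lev :: "'v set set \<Rightarrow> 'v \<Rightarrow> nat \<Rightarrow> 'v cover_vertex \<Rightarrow> bool" for K b where
  lev_base: "lev K b 0 (Nd b Map.empty)"
| lev_up: "lev K b n s \<Longrightarrow> up K s x \<Longrightarrow> lev K b (Suc n) (step K s x)"

text \<open>The last clause says that the lower neighbours of \<open>s\<close> are complete: a
  horizontal neighbour of \<open>d\<close> that spans a triangle with \<open>d\<close> and
  \<open>s\<close> is among them. \<open>hor_step\<close> needs this to see that certain edges go up
  from \<open>d\<close>.\<close>

definition lower_ok :: "'v set set \<Rightarrow> 'v \<Rightarrow> nat \<Rightarrow> 'v cover_vertex \<Rightarrow> 'v \<Rightarrow> 'v cover_vertex \<Rightarrow> bool" where
  "lower_ok K b m s u d \<longleftrightarrow>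
     lev K b m d \<and> lab d = u \<and> up K d (lab s) \<and> step K d (lab s) = s \<and>
     (\<forall>y. hor K d y \<and> tri K u y (lab s) \<longrightarrow> y \<in> dom (low s))"

definition lowers_adjacent :: "'v set set \<Rightarrow> 'v cover_vertex \<Rightarrow> 'v \<Rightarrow> 'v cover_vertex \<Rightarrow> 'v \<Rightarrow> 'v cover_vertex \<Rightarrow> bool" where
  "lowers_adjacent K s u d u' d' \<longleftrightarrow> tri K u u' (lab s) \<and> step K d u' = d'"

text \<open>The invariant carried from level to level. At \<open>n = 0\<close> the value
  \<open>n - 1\<close> is harmless because \<open>low s\<close> is empty there.\<close>

definition wellformed :: "'v set set \<Rightarrow> 'v \<Rightarrow> nat \<Rightarrow> 'v cover_vertex \<Rightarrow> bool" where
  "wellformed K b n s \<longleftrightarrow>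
     {lab s} \<in> K \<and> (n = 0 \<longleftrightarrow> low s = Map.empty) \<and>
     (\<forall>u d. low s u = Some d \<longrightarrow> lower_ok K b (n - 1) s u d) \<and>
     (\<forall>u u' d d'. low s u = Some d \<longrightarrow> low s u' = Some d' \<longrightarrow> u \<noteq> u' \<longrightarrow>
        lowers_adjacent K s u d u' d')"

text \<open>The girth condition in terms of triangles at \<open>v\<close>. Consecutive vertices of
  the link cycle are distinct by \<open>tri\<close>; only the remaining inequalities are
  stated.\<close>

locale large_girth_links =
  fixes K :: "'v set set"
  assumes cx: "simplicial_cx K"
    and no3: "\<lbrakk>tri K v x y; tri K v y z; tri K v z x\<rbrakk> \<Longrightarrow> False"
    and no4: "\<lbrakk>tri K v x y; tri K v y z; tri K v z w; tri K v w x; x \<noteq> z; y \<noteq> w\<rbrakk> \<Longrightarrow> False"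
    and no5: "\<lbrakk>tri K v x y; tri K v y z; tri K v z w; tri K v w t; tri K v t x;
               distinct [x, y, z, w, t]\<rbrakk> \<Longrightarrow> False"
begin

lemma face: "s \<in> K \<Longrightarrow> t \<subseteq> s \<Longrightarrow> t \<noteq> {} \<Longrightarrow> t \<in> K"
  by (rule simplicial_cx_face[OF cx])

lemma tri_edge: "tri K u v w \<Longrightarrow> {u, w} \<in> K \<and> {v, w} \<in> K \<and> {u, v} \<in> K"
  using face[of "{u, v, w}" "{u, w}"] face[of "{u, v, w}" "{v, w}"] face[of "{u, v, w}" "{u, v}"]
  by (simp add: tri_def)

section \<open>Vertices of one level and their neighbours\<close>

context
  fixes b :: 'v and n :: nat
  assumes wf_n: "\<And>s. lev K b n s \<Longrightarrow> wellformed K b n s"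
begin

lemma low_facts:
  assumes "lev K b n s" "low s u = Some d"
  obtains m where "n = Suc m" "lev K b m d" "lab d = u" "up K d (lab s)" "step K d (lab s) = s"
    "u \<noteq> lab s" "{u, lab s} \<in> K"
    "\<And>y. hor K d y \<Longrightarrow> tri K u y (lab s) \<Longrightarrow> y \<in> dom (low s)"
proof -
  note wf = wf_n[OF assms(1), unfolded wellformed_def]
  have "low s \<noteq> Map.empty"
    using assms(2) by auto
  then have "n \<noteq> 0"
    using wf[THEN conjunct2, THEN conjunct1] by iprover
  then obtain m where n: "n = Suc m"
    using not0_implies_Suc by blast
  have "lower_ok K b (n - 1) s u d"
    using wf[THEN conjunct2, THEN conjunct2, THEN conjunct1] assms(2) by iprover
  then have *: "lev K b m d" "lab d = u" "up K d (lab s)" "step K d (lab s) = s"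
    "\<And>y. hor K d y \<Longrightarrow> tri K u y (lab s) \<Longrightarrow> y \<in> dom (low s)"
    unfolding lower_ok_def n diff_Suc_1 by iprover+
  have "u \<noteq> lab s" "{u, lab s} \<in> K"
    using *(2,3) by (auto simp: up_def)
  with n * show ?thesis
    using that by iprover
qed

lemma low_tri:
  assumes "lev K b n s" "low s u = Some d" "low s u' = Some d'" "u \<noteq> u'"
  shows "tri K u u' (lab s)" "step K d u' = d'"
proof -
  have "lowers_adjacent K s u d u' d'"
    using wf_n[OF assms(1), unfolded wellformed_def, THEN conjunct2, THEN conjunct2, THEN conjunct2]
      assms(2-4) by iprover
  then show "tri K u u' (lab s)" "step K d u' = d'"
    by (simp_all add: lowers_adjacent_def)
qed

text \<open>Two lower neighbours are adjacent, so together with \<open>x\<close> they would form a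
  3-cycle in the link of \<open>lab s\<close>.\<close>

lemma via_unique:
  assumes "lev K b n s" "via K s x u" "via K s x u'"
  shows "u = u'"
proof (rule ccontr)
  assume "u \<noteq> u'"
  then have "tri K u u' (lab s)"
    using low_tri(1)[OF assms(1)] assms(2,3) by (auto simp: via_def)
  with assms(2,3) show False
    using no3[of "lab s" u u' x] by (auto simp: via_def tri_commute)
qed

text \<open>The triangle spanned by \<open>u\<close>, \<open>lab s\<close> and \<open>x\<close> is
  seen from \<open>d\<close>. If \<open>x\<close> were below \<open>d\<close>, then
  \<open>lab s\<close> would be horizontal from \<open>d\<close>; if \<open>x\<close> were
  horizontal from \<open>d\<close>, completeness in \<open>lower_ok\<close> would put
  \<open>x\<close> below \<open>s\<close>. So the edge to \<open>x\<close> goes up from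
  \<open>d\<close>.\<close>

lemma hor_step:
  assumes "lev K b n s" "hor K s x" "low s u = Some d" "tri K u (lab s) x"
  shows "step K s x = step K d x" "up K d x"
proof -
  obtain u0 d0 where "low s u0 = Some d0" "tri K u0 (lab s) x" "step K s x = step K d0 x"
    using step_hor[OF assms(2)] by blast
  moreover have "u0 = u"
    using via_unique[OF assms(1)] calculation assms(3,4) by (auto simp: via_def)
  ultimately show "step K s x = step K d x"
    using assms(3) by simp
  obtain m where d: "lab d = u" "up K d (lab s)"
      "\<And>y. hor K d y \<Longrightarrow> tri K u y (lab s) \<Longrightarrow> y \<in> dom (low s)"
    using low_facts[OF assms(1,3)] by metis
  have "{u, x} \<in> K" "x \<noteq> u"
    using tri_edge[OF assms(4)] tri_neq[OF assms(4)] by auto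
  moreover have "x \<notin> dom (low d)"
    using d(1,2) assms(4) by (auto simp: up_def via_def tri_commute)
  moreover from this have "\<nexists>y. via K d x y"
    using d(3)[of x] assms(2,4) by (auto simp: hor_def tri_commute)
  ultimately show "up K d x"
    by (simp add: up_def d(1))
qed

lemma hor_lev:
  assumes "lev K b n s" "hor K s x"
  shows "lev K b n (step K s x)" "lab (step K s x) = x"
proof -
  obtain u d where u: "low s u = Some d" "tri K u (lab s) x"
    using assms(2) by (rule horE)
  obtain m where "n = Suc m" "lev K b m d"
    using low_facts[OF assms(1) u(1)] by metis
  note m = this and h = hor_step[OF assms u]
  show "lev K b n (step K s x)"
    using lev_up[OF m(2) h(2)] by (simp add: m(1) h(1))
  show "lab (step K s x) = x"
    using lab_step_up[OF h(2)] by (simp add: h(1))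
qed

text \<open>Both ends of a horizontal edge are upper neighbours of the same \<open>d\<close>, which
  makes the relation symmetric.\<close>

lemma hor_rev:
  assumes "lev K b n s" "hor K s x"
  shows "hor K (step K s x) (lab s)" "step K (step K s x) (lab s) = s"
    "low s u = Some d \<Longrightarrow> tri K u (lab s) x \<Longrightarrow> low (step K s x) u = Some d"
proof -
  let ?t = "step K s x"
  have *: "low ?t u = Some d" if "low s u = Some d" "tri K u (lab s) x" for u d
    using hor_step[OF assms that] low_facts[OF assms(1) that(1)] by (metis low_step_up)
  then show "low s u = Some d \<Longrightarrow> tri K u (lab s) x \<Longrightarrow> low ?t u = Some d" .
  obtain u d where u: "low s u = Some d" "tri K u (lab s) x"
    using assms(2) by (rule horE)
  note h = hor_step[OF assms u] and t = hor_lev[OF assms]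
  obtain m where d: "lab d = u" "up K d (lab s)" "step K d (lab s) = s"
    using low_facts[OF assms(1) u(1)] by metis
  have "lab s \<notin> dom (low ?t)"
    using d u tri_neq[OF u(2)] by (auto simp: h(1) low_step_up[OF h(2)] up_def hor_def split: if_splits)
  moreover have "tri K u x (lab s)"
    using u(2) by (simp add: tri_commute)
  ultimately show "hor K ?t (lab s)"
    using *[OF u] t(2) by (auto simp: hor_def via_def)
  from hor_step(1)[OF t(1) this *[OF u]] show "step K ?t (lab s) = s"
    using t(2) \<open>tri K u x (lab s)\<close> d(3) by simp
qed

text \<open>The link of \<open>lab s\<close> would contain the cycle \<open>u\<close>,
  \<open>x\<close>, \<open>y\<close> or the cycle \<open>u\<close>, \<open>x\<close>,
  \<open>y\<close>, \<open>u'\<close>.\<close>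

lemma hor_hor_not_tri:
  assumes "lev K b n s" "hor K s x" "hor K s y"
  shows "\<not> tri K (lab s) x y"
proof
  assume xy: "tri K (lab s) x y"
  obtain u d u' d' where u: "low s u = Some d" "tri K u (lab s) x"
    "low s u' = Some d'" "tri K u' (lab s) y"
    using assms(2,3) horE by metis
  show False
  proof (cases "u = u'")
    case True
    then show ?thesis
      using no3[of "lab s" u x y] u xy by (simp add: tri_commute)
  next
    case False
    then have "tri K u u' (lab s)"
      using low_tri(1)[OF assms(1)] u by blast
    moreover have "u \<noteq> y" "x \<noteq> u'"
      using assms(2,3) u by (auto simp: hor_def)
    ultimately show ?thesis
      using no4[of "lab s" u x y u'] u xy by (simp add: tri_commute)
  qed
qed

text \<open>Otherwise the link of \<open>lab s\<close> contains the 4-cycle \<open>u\<close>,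
  \<open>x\<close>, \<open>y\<close>, \<open>x'\<close> or the 5-cycle \<open>u\<close>,
  \<open>x\<close>, \<open>y\<close>, \<open>x'\<close>, \<open>u'\<close>. In the construction of
  the cover, 5-cycles have to be excluded only here.\<close>

lemma hor_unique:
  assumes "lev K b n s" "hor K s x" "hor K s x'" "y \<notin> dom (low s)"
    "tri K (lab s) x y" "tri K (lab s) x' y"
  shows "x = x'"
proof (rule ccontr)
  assume ne: "x \<noteq> x'"
  obtain u d u' d' where u: "low s u = Some d" "tri K u (lab s) x"
    "low s u' = Some d'" "tri K u' (lab s) x'"
    using assms(2,3) horE by metis
  have yu: "y \<noteq> u" "y \<noteq> u'" "x \<noteq> u'" "x' \<noteq> u" "x \<noteq> y" "x' \<noteq> y" "x \<noteq> u" "x' \<noteq> u'"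
    using assms u by (auto simp: hor_def tri_def)
  show False
  proof (cases "u = u'")
    case True
    then show ?thesis
      using no4[of "lab s" u x y x'] u assms(5,6) ne yu by (simp add: tri_commute)
  next
    case False
    then have "tri K u u' (lab s)"
      using low_tri(1)[OF assms(1)] u by blast
    then show ?thesis
      using no5[of "lab s" u x y x' u'] u assms(5,6) ne yu False
      by (simp add: tri_commute)
  qed
qed

text \<open>The gluing of two upward steps. By \<open>hor_unique\<close>, seen from \<open>s\<close>
  and from its horizontal neighbour, both results have exactly these two vertices as lower
  neighbours, so they are equal as data. That the second edge goes up at all follows from the
  absence of 3- and 4-cycles in the link of \<open>x\<close>.\<close>

lemma hor_up:
  assumes "lev K b n s" "hor K s x" "up K s y" "tri K (lab s) x y"
  shows "up K (step K s x) y" "step K (step K s x) y = step K s y"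
proof -
  let ?t = "step K s x" and ?v = "lab s"
  note t = hor_lev[OF assms(1,2)] and rev = hor_rev[OF assms(1,2)]
  obtain u d where u: "low s u = Some d" "tri K u ?v x"
    using assms(2) by (rule horE)
  have tu: "low ?t u = Some d"
    using rev(3)[OF u] .
  have yu: "y \<noteq> u"
    using assms(3) u by (auto simp: up_def)
  have y_low: "y \<notin> dom (low ?t)"
  proof
    assume "y \<in> dom (low ?t)"
    then have "tri K y u x"
      using low_tri(1)[OF t(1)] tu yu t(2) by auto
    then show False
      using no3[of x y u ?v] u assms(4) by (simp add: tri_commute)
  qed
  moreover have "\<not> via K ?t y w" for w
  proof
    assume w: "via K ?t y w"
    show False
    proof (cases "w = u")
      case True
      then show ?thesis
        using no3[of x u y ?v] u assms(4) w t(2) by (simp add: via_def tri_commute)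
    next
      case False
      then have "tri K w u x"
        using low_tri(1)[OF t(1) _ tu] w t(2) by (auto simp: via_def)
      moreover have "w \<noteq> ?v"
        using w rev(1) by (auto simp: via_def hor_def)
      ultimately show ?thesis
        using no4[of x u w y ?v] u assms(4) w t(2) yu by (simp add: via_def tri_commute)
    qed
  qed
  moreover have "{x, y} \<in> K" "x \<noteq> y"
    using tri_edge[OF assms(4)] tri_neq[OF assms(4)] by simp_all
  ultimately show up: "up K ?t y"
    using t(2) by (auto simp: up_def)
  have ys: "y \<notin> dom (low s)"
    using assms(3) by (auto simp: up_def)
  have tri': "tri K x ?v y"
    using assms(4) by (simp add: tri_commute)
  have "hor K s z \<and> tri K ?v z y \<longleftrightarrow> z = x" for z
    using hor_unique[OF assms(1) _ assms(2) ys _ assms(4), of z] assms(2,4) by iprover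
  moreover have "hor K ?t z \<and> tri K x z y \<longleftrightarrow> z = ?v" for z
    using hor_unique[OF t(1) _ rev(1) y_low, of z] rev(1) tri' unfolding t(2) by iprover
  moreover have "x \<noteq> ?v"
    using tri_neq[OF tri'] by simp
  ultimately show "step K ?t y = step K s y"
    unfolding step_up[OF up] step_up[OF assms(3)] t(2)
    by (auto simp: fun_eq_iff rev(2))
qed

text \<open>The lower neighbours of the new vertex are \<open>s\<close> and, by
  \<open>hor_unique\<close>, at most one horizontal neighbour of \<open>s\<close>. For either of
  them, the other is the only horizontal neighbour that completeness has to account for.\<close>

lemma wf_step_up:
  assumes "lev K b n s" "up K s x"
  shows "wellformed K b (Suc n) (step K s x)"
proof -
  let ?v = "lab s" and ?t = "step K s x"
  have lab: "lab ?t = x"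
    by (rule lab_step_up[OF assms(2)])
  have xs: "x \<notin> dom (low s)"
    using assms(2) by (simp add: up_def)
  have cases: "(u = ?v \<and> d = s) \<or> (hor K s u \<and> tri K ?v u x \<and> d = step K s u)"
    if "low ?t u = Some d" for u d
    using that by (auto simp: low_step_up[OF assms(2)] split: if_splits)
  have dom: "u \<in> dom (low ?t) \<longleftrightarrow> u = ?v \<or> (hor K s u \<and> tri K ?v u x)" for u
    by (auto simp: low_step_up[OF assms(2)] split: if_splits)
  have a: "lower_ok K b n ?t u d" if d: "low ?t u = Some d" for u d
    using cases[OF d]
  proof (elim disjE conjE)
    assume "u = ?v" "d = s"
    then show ?thesis
      using assms by (simp add: lower_ok_def lab dom del: domIff)
  next
    assume hu: "hor K s u" "tri K ?v u x" and d: "d = step K s u"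
    note t = hor_lev[OF assms(1) hu(1)] and rev = hor_rev[OF assms(1) hu(1)]
      and u = hor_up[OF assms(1) hu(1) assms(2) hu(2)]
    have "x \<notin> dom (low d)"
      using u(1) by (simp add: up_def d)
    then have "y = ?v" if "hor K d y" "tri K u y x" for y
      using hor_unique[OF t(1), of y ?v x] that rev(1) t(2) hu(2)
      by (simp add: d tri_commute del: domIff)
    then show ?thesis
      using t u by (auto simp: lower_ok_def lab d dom simp del: domIff)
  qed
  have b: "lowers_adjacent K ?t u d u' d'"
    if d: "low ?t u = Some d" "low ?t u' = Some d'" "u \<noteq> u'" for u u' d d'
  proof -
    have "\<not> (hor K s u \<and> tri K ?v u x \<and> hor K s u' \<and> tri K ?v u' x)"
      using hor_unique[OF assms(1) _ _ xs, of u u'] d(3) by iprover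
    with cases[OF d(1)] cases[OF d(2)] d(3)
    consider "u = ?v" "d = s" "tri K ?v u' x" "d' = step K s u'"
      | "u' = ?v" "d' = s" "hor K s u" "tri K ?v u x" "d = step K s u"
      by blast
    then show ?thesis
    proof cases
      case 1
      then show ?thesis
        by (simp add: lowers_adjacent_def lab)
    next
      case 2
      then show ?thesis
        using hor_rev(2)[OF assms(1)] by (simp add: lowers_adjacent_def lab tri_commute)
    qed
  qed
  have "{x} \<in> K"
    using assms(2) face[of "{?v, x}" "{x}"] by (simp add: up_def)
  moreover have "low ?t \<noteq> Map.empty"
    using dom[of ?v] by auto
  ultimately show ?thesis
    unfolding wellformed_def lab diff_Suc_1
    by (intro conjI allI impI) (simp_all add: a b)
qed

end

lemma wellformed_lev:
  assumes "{b} \<in> K"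
  shows "lev K b n s \<Longrightarrow> wellformed K b n s"
proof (induction n arbitrary: s)
  case 0
  then show ?case
    by (cases rule: lev.cases) (auto simp: wellformed_def assms)
next
  case (Suc n)
  from Suc.prems obtain s' x where "s = step K s' x" "lev K b n s'" "up K s' x"
    by (cases rule: lev.cases) auto
  then show ?case
    using wf_step_up[OF Suc.IH] by blast
qed

lemma step_types:
  assumes "{lab s, x} \<in> K" "x \<noteq> lab s"
  obtains d where "low s x = Some d" | "hor K s x" | "up K s x"
  using assms unfolding hor_def up_def by (metis domD)

section \<open>Lifting edges and triangles to the cover\<close>

context
  fixes b
  assumes b: "{b} \<in> K"
begin

lemma step_lev:
  assumes "lev K b n s" "{lab s, x} \<in> K"
  shows "lab (step K s x) = x"
    "\<exists>m. lev K b m (step K s x) \<and> m \<le> Suc n"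
    "low s x = Some d \<Longrightarrow> \<exists>m. n = Suc m \<and> lev K b m (step K s x)"
    "hor K s x \<Longrightarrow> lev K b n (step K s x)"
    "up K s x \<Longrightarrow> lev K b (Suc n) (step K s x)"
proof -
  note wf = wellformed_lev[OF b]
  have L: "lab (step K s x) = x \<and> (\<exists>m. n = Suc m \<and> lev K b m (step K s x))"
    if "low s x = Some d" for d
    using low_facts[OF wf assms(1) that] step_low[OF that] by metis
  show "low s x = Some d \<Longrightarrow> \<exists>m. n = Suc m \<and> lev K b m (step K s x)"
    using L by blast
  show H: "hor K s x \<Longrightarrow> lev K b n (step K s x)"
    using hor_lev[OF wf assms(1)] by blast
  show U: "up K s x \<Longrightarrow> lev K b (Suc n) (step K s x)"
    using assms(1) by (rule lev_up)
  consider "x = lab s" | d where "low s x = Some d" | "hor K s x" | "up K s x"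
    using step_types[OF assms(2)] by metis
  then show "\<exists>m. lev K b m (step K s x) \<and> m \<le> Suc n"
  proof cases
    case 1
    then show ?thesis
      using assms(1) by (intro exI[of _ n]) simp
  next
    case 2
    then show ?thesis
      using L by fastforce
  next
    case 3
    then show ?thesis
      using H by (intro exI[of _ n]) simp
  next
    case 4
    then show ?thesis
      using U by blast
  qed
  consider "x = lab s" | d where "low s x = Some d" | "hor K s x" | "up K s x"
    using step_types[OF assms(2)] by metis
  then show "lab (step K s x) = x"
    by cases (use L hor_lev[OF wf assms(1)] lab_step_up[of K s x] in auto)
qed

lemma step_back:
  assumes s: "lev K b n s" and "{lab s, x} \<in> K"
  shows "step K (step K s x) (lab s) = s"
proof (cases "x = lab s")
  case False
  note wf = wellformed_lev[OF b]
  show ?thesis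
    using assms(2) False
  proof (cases rule: step_types)
    case (1 d)
    then show ?thesis
      using low_facts[OF wf s 1] step_low[OF 1] False by metis
  next
    case 2
    then show ?thesis
      using hor_rev(2)[OF wf s] by blast
  next
    case 3
    have "low (step K s x) (lab s) = Some s"
      using low_step_up[OF 3] by simp
    then show ?thesis
      using step_low lab_step_up[OF 3] False by metis
  qed
qed simp

text \<open>The triangle axiom of \<open>simplicial_cover\<close>, by the types of the two edges at
  \<open>s\<close>. A lower and an upper vertex never span a triangle with \<open>s\<close>, by the
  definition of \<open>up\<close>, nor do two horizontal ones, by
  \<open>hor_hor_not_tri\<close>.\<close>

lemma step_step:
  assumes s: "lev K b n s" and K: "{lab s, x, y} \<in> K"
  shows "step K (step K s x) y = step K s y"
proof -
  note wf = wellformed_lev[OF b]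
  let ?v = "lab s" and ?t = "step K s x"
  have x: "{?v, x} \<in> K" and y: "{?v, y} \<in> K"
    using face[OF K, of "{?v, x}"] face[OF K, of "{?v, y}"] by auto
  note labt = step_lev(1)[OF s x]
  show ?thesis
  proof (cases "tri K ?v x y")
    case False
    with K consider "x = ?v" | "y = x" | "y = ?v"
      by (auto simp: tri_def)
    then show ?thesis
      by cases (use step_back[OF s x] step_lab[of K ?t] labt in auto)
  next
    case T: True
    have ne: "x \<noteq> ?v" "y \<noteq> ?v"
      using T tri_neq by metis+
    have noU: False if "low s z = Some d" "up K s z'" "tri K ?v z z'" for z z' d
      using that by (auto simp: up_def via_def tri_commute)
    from y ne(2) show ?thesis
    proof (cases rule: step_types)
      case y: (1 d')
      from x ne(1) show ?thesis
      proof (cases rule: step_types)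
        case (1 d)
        then show ?thesis
          using low_tri(2)[OF wf s 1 y] tri_neq[OF T] step_low[OF 1 ne(1)] step_low[OF y ne(2)]
          by simp
      next
        case 2
        then have "low ?t y = Some d'"
          using hor_rev(3)[OF wf s 2 y] T by (simp add: tri_commute)
        then show ?thesis
          using step_low[of ?t y d' K] step_low[OF y ne(2)] labt tri_neq[OF T] by auto
      next
        case 3
        then show ?thesis
          using noU[OF y 3] T by (simp add: tri_commute)
      qed
    next
      case y: 2
      from x ne(1) show ?thesis
      proof (cases rule: step_types)
        case (1 d)
        then show ?thesis
          using hor_step(1)[OF wf s y 1] T step_low[OF 1] ne by (simp add: tri_commute)
      next
        case 2
        then show ?thesis
          using hor_hor_not_tri[OF wf s 2 y] T by blast
      next
        case 3
        then have "low ?t y = Some (step K s y)"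
          using low_step_up[OF 3] y T ne by (simp add: tri_commute)
        then show ?thesis
          using step_low[of ?t y "step K s y" K] labt tri_neq[OF T] by auto
      qed
    next
      case y: 3
      from x ne(1) show ?thesis
      proof (cases rule: step_types)
        case (1 d)
        then show ?thesis
          using noU[OF 1 y T] by blast
      next
        case 2
        then show ?thesis
          using hor_up(2)[OF wf s 2 y T] by blast
      next
        \<comment> \<open>Two upper neighbours: the third side of the triangle is a horizontal edge
          one level higher, and it is lifted through the lower neighbour \<open>s\<close> of
          \<open>?t\<close>.\<close>
        case 3
        have t: "lev K b (Suc n) ?t"
          using lev_up[OF s 3] .
        have "low ?t ?v = Some s"
          using low_step_up[OF 3] by simp
        moreover have "y \<notin> dom (low ?t)"
          using low_step_up[OF 3] y ne(2) by (auto simp: hor_def up_def)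
        ultimately have "hor K ?t y"
          using T labt by (auto simp: hor_def via_def)
        then show ?thesis
          using hor_step(1)[OF wf t _ \<open>low ?t ?v = Some s\<close>] T labt by simp
      qed
    qed
  qed
qed

text \<open>\<open>lev\<close> is only a relation. Following a lower neighbour decreases both levels
  at once, and at level 0 no lower neighbour is left.\<close>

lemma lev_unique: "lev K b n s \<Longrightarrow> lev K b m s \<Longrightarrow> m = n"
proof (induction n arbitrary: m s)
  case 0
  then show ?case
    using wellformed_lev[OF b 0(1)] wellformed_lev[OF b 0(2)]
    unfolding wellformed_def by blast
next
  case (Suc n)
  note w = wellformed_lev[OF b Suc.prems(1)] wellformed_lev[OF b Suc.prems(2)]
  have "low s \<noteq> Map.empty"
    using w(1) unfolding wellformed_def by blast
  then obtain u d where d: "low s u = Some d"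
    by fastforce
  have "m \<noteq> 0"
    using w(2) \<open>low s \<noteq> Map.empty\<close> unfolding wellformed_def by blast
  moreover have "lev K b n d"
    using w(1) d unfolding wellformed_def lower_ok_def diff_Suc_1 by blast
  moreover have "lev K b (m - 1) d"
    using w(2) d unfolding wellformed_def lower_ok_def by blast
  ultimately show ?case
    using Suc.IH by fastforce
qed

end
end

section \<open>The distance to the basepoint and the squaring\<close>

lemma girth_le: "embedded_cycle G c \<Longrightarrow> girth G \<le> enat (length c)"
  unfolding girth_def by (rule INF_lower) simp

lemma link_edge:
  assumes "tri K v x y"
  shows "{x, y} \<in> edges (link K v)"
proof -
  have "card {v, x, y} = 3" "{v, x, y} \<in> K"
    using assms by (auto simp: tri_def)
  then show ?thesis
    unfolding link_def by auto
qed

lemma link_vertex: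
  assumes "simplicial_cx K" "tri K v x y"
  shows "x \<in> verts (link K v)"
proof -
  have "{v, x} \<in> K"
    using simplicial_cx_face[OF assms(1), of "{v, x, y}" "{v, x}"] assms(2) by (simp add: tri_def)
  moreover have "card {v, x} = 2"
    using assms(2) by (simp add: tri_def)
  ultimately show ?thesis
    by (simp add: link_def one_skeleton_def)
qed

lemma systolic_large_girth_links:
  assumes "systolic_2cx Y"
  shows "large_girth_links Y"
proof
  show cx: "simplicial_cx Y"
    using assms by (simp add: systolic_2cx_def)
  have no_cycle: False if c: "tri Y v x y" "embedded_cycle (link Y v) c" "length c < 6" for v x y c
  proof -
    have "v \<in> \<Union>Y"
      using c(1) by (auto simp: tri_def)
    then have "6 \<le> girth (link Y v)"
      using assms unfolding systolic_2cx_def by blast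
    also have "\<dots> \<le> enat (length c)"
      by (rule girth_le[OF c(2)])
    finally show False
      using c(3) by (simp add: numeral_eq_enat)
  qed
  note edge = link_edge[of Y] and vertex = link_vertex[OF cx]
  show False if t: "tri Y v x y" "tri Y v y z" "tri Y v z x" for v x y z
  proof (rule no_cycle[OF t(1)])
    show "embedded_cycle (link Y v) [x, y, z]"
      using t[THEN edge] t[THEN vertex] t[THEN tri_neq]
      unfolding embedded_cycle_def cycle_edges_image
      by (auto simp: lessThan_Suc)
  qed simp
  show False if t: "tri Y v x y" "tri Y v y z" "tri Y v z w" "tri Y v w x" "x \<noteq> z" "y \<noteq> w"
    for v x y z w
  proof (rule no_cycle[OF t(1)])
    show "embedded_cycle (link Y v) [x, y, z, w]"
      using t(1-4)[THEN edge] t(1-4)[THEN vertex] t(1-4)[THEN tri_neq] t(5,6)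
      unfolding embedded_cycle_def cycle_edges_image
      by (auto simp: lessThan_Suc)
  qed simp
  show False if t: "tri Y v x y" "tri Y v y z" "tri Y v z w" "tri Y v w s" "tri Y v s x"
    "distinct [x, y, z, w, s]" for v x y z w s
  proof (rule no_cycle[OF t(1)])
    show "embedded_cycle (link Y v) [x, y, z, w, s]"
      using t(1-5)[THEN edge] t(1-5)[THEN vertex] t(6)
      unfolding embedded_cycle_def cycle_edges_image
      by (auto simp: lessThan_Suc)
  qed simp
qed

lemma lev_0: "lev K b 0 s \<Longrightarrow> s = Nd b Map.empty"
  by (erule lev.cases) simp_all

text \<open>\<open>lab\<close> is a bijection from the cover onto the vertices of \<open>K\<close>:
  edge paths from \<open>b\<close> lift, and \<open>monodromy\<close> makes lifts unique. The number
  \<open>l v\<close> is the level of the only lift of \<open>v\<close>, and the listed properties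
  are read off \<open>wellformed\<close> and \<open>hor\<close> at this lift.\<close>

lemma (in large_girth_links) ex_level_function:
  assumes sc: "simply_connected_top (realization K)" and b: "{b} \<in> K"
  obtains l :: "'v \<Rightarrow> nat" where "l b = 0"
    "\<And>v x. {v, x} \<in> K \<Longrightarrow> l x \<le> Suc (l v)"
    "\<And>v. {v} \<in> K \<Longrightarrow> v \<noteq> b \<Longrightarrow> \<exists>u. {u, v} \<in> K \<and> Suc (l u) = l v"
    "\<And>v u u'. {u, v} \<in> K \<Longrightarrow> {u', v} \<in> K \<Longrightarrow> u \<noteq> u' \<Longrightarrow> Suc (l u) = l v \<Longrightarrow> Suc (l u') = l v \<Longrightarrow>
       tri K u u' v"
    "\<And>v x. {v, x} \<in> K \<Longrightarrow> v \<noteq> x \<Longrightarrow> l v = l x \<Longrightarrow> \<exists>u. tri K u v x \<and> Suc (l u) = l v"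
proof -
  note wf = wellformed_lev[OF b]
  define S where "S = {s. \<exists>n. lev K b n s}"
  interpret C: simplicial_cover K S lab "step K"
  proof
    show "simplicial_cx K"
      by (rule cx)
    fix s assume "s \<in> S"
    then obtain n where s: "lev K b n s"
      unfolding S_def by blast
    show "step K s (lab s) = s"
      by simp
    show "step K s x \<in> S \<and> lab (step K s x) = x" if "{lab s, x} \<in> K" for x
      using step_lev(1,2)[OF b s that] unfolding S_def by blast
    show "step K (step K s x) y = step K s y" if "{lab s, x, y} \<in> K" for x y
      by (rule step_step[OF b s that])
  qed
  let ?base = "Nd b Map.empty :: 'v cover_vertex"
  define R where "R s t \<longleftrightarrow> s \<in> S \<and> t \<in> S \<and> {lab s, lab t} \<in> K \<and> t = step K s (lab t)" for s t
  \<comment> \<open>Both directions are recorded because the walk between two lifts of a vertex is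
    led through the base.\<close>
  have conn: "R\<^sup>*\<^sup>* s ?base \<and> R\<^sup>*\<^sup>* ?base s" if "lev K b n s" for n s
    using that
  proof (induction rule: lev.induct)
    case (lev_up n s x)
    let ?t = "step K s x"
    have x: "{lab s, x} \<in> K" "lab ?t = x"
      using lev_up.hyps(2) lab_step_up[OF lev_up.hyps(2)] by (simp_all add: up_def)
    have "s \<in> S" "?t \<in> S"
      using lev_up.hyps(1) lev.lev_up[OF lev_up.hyps] unfolding S_def by blast+
    then have "R s ?t" "R ?t s"
      using x step_back[OF b lev_up.hyps(1) x(1)] by (simp_all add: R_def insert_commute)
    with lev_up.IH show ?case
      by (meson converse_rtranclp_into_rtranclp rtranclp.rtrancl_into_rtrancl)
  qed simp
  have unique: "s = t" if st: "s \<in> S" "t \<in> S" "lab s = lab t" for s t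
  proof -
    have "R\<^sup>*\<^sup>* s ?base" "R\<^sup>*\<^sup>* ?base t"
      using st(1,2) conn unfolding S_def by blast+
    then have "R\<^sup>*\<^sup>* s t"
      by (rule rtranclp_trans)
    then obtain n where "(R ^^ n) s t"
      using rtranclp_imp_relpowp by fast
    then obtain f where f: "f 0 = s" "f n = t" "\<And>i. i < n \<Longrightarrow> R (f i) (f (Suc i))"
      unfolding relpowp_fun_conv by blast
    have "f n = f 0"
    proof (rule C.monodromy[OF sc])
      show "f i \<in> S" if "i \<le> n" for i
        using f st(2) that by (cases "i = n") (auto simp: R_def)
    qed (use f st(3) in \<open>auto simp: R_def\<close>)
    then show ?thesis
      using f(1,2) by simp
  qed
  have "\<exists>n s. lev K b n s \<and> lab s = v" if v: "{v} \<in> K" for v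
  proof -
    obtain N w where w: "w 0 = b" "w N = v" "\<And>i. i < N \<Longrightarrow> {w i, w (Suc i)} \<in> K"
      using path_vertices[OF cx sc b v] by metis
    have "\<exists>n s. lev K b n s \<and> lab s = w i" if "i \<le> N" for i
      using that
    proof (induction i)
      case 0
      then show ?case
        using lev_base w(1) by (metis cover_vertex.sel(1))
    next
      case (Suc i)
      then obtain n s where s: "lev K b n s" "lab s = w i"
        by auto
      have "{lab s, w (Suc i)} \<in> K"
        using w(3)[of i] Suc.prems s(2) by simp
      then show ?case
        using step_lev(1,2)[OF b s(1)] by blast
    qed
    then show ?thesis
      using w(2) by blast
  qed
  then obtain l \<sigma> where l\<sigma>: "\<And>v. {v} \<in> K \<Longrightarrow> lev K b (l v) (\<sigma> v) \<and> lab (\<sigma> v) = v"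
    by metis
  have verts: "{v} \<in> K \<and> {x} \<in> K" if "{v, x} \<in> K" for v x
    using face[OF that, of "{v}"] face[OF that, of "{x}"] by simp
  have lev_l: "l v = n" if "lev K b n s" "lab s = v" "{v} \<in> K" for n s v
  proof -
    have "s = \<sigma> v"
      using that l\<sigma>[OF that(3)] by (intro unique) (auto simp: S_def)
    then show ?thesis
      using that(1) l\<sigma>[OF that(3)] lev_unique[OF b] by blast
  qed
  \<comment> \<open>The kind of an edge at the lift determines the difference of levels. The three
    differences exclude one another, so conversely the level of \<open>x\<close> tells the
    kind.\<close>
  have types: "(\<exists>d. low (\<sigma> v) x = Some d) \<and> Suc (l x) = l v \<or> hor K (\<sigma> v) x \<and> l x = l v \<or>
      l x = Suc (l v)" if vx: "{v, x} \<in> K" "x \<noteq> v" for v x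
  proof -
    have v: "lev K b (l v) (\<sigma> v)" "lab (\<sigma> v) = v"
      using l\<sigma> verts[OF vx(1)] by blast+
    have e: "{lab (\<sigma> v), x} \<in> K"
      using v(2) vx(1) by simp
    note st = step_lev[OF b v(1) e]
    have x: "{x} \<in> K"
      using verts[OF vx(1)] by blast
    from e have "x \<noteq> lab (\<sigma> v)"
      using v(2) vx(2) by simp
    with e show ?thesis
    proof (cases rule: step_types)
      case (1 d)
      then show ?thesis
        using st(3)[OF 1] lev_l[OF _ st(1) x] by auto
    next
      case 2
      then show ?thesis
        using lev_l[OF st(4)[OF 2] st(1) x] by blast
    next
      case 3
      then show ?thesis
        using lev_l[OF st(5)[OF 3] st(1) x] by blast
    qed
  qed
  show ?thesis
  proof (rule that[of l])
    show "l b = 0"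
      by (rule lev_l[OF lev_base _ b]) simp
    show "l x \<le> Suc (l v)" if "{v, x} \<in> K" for v x
      using types[OF that] by (cases "x = v") auto
  next
    fix v assume v: "{v} \<in> K" "v \<noteq> b"
    have s: "lev K b (l v) (\<sigma> v)" "lab (\<sigma> v) = v"
      using l\<sigma>[OF v(1)] by blast+
    have "\<sigma> v \<noteq> ?base"
      using s(2) v(2) by auto
    then have "l v \<noteq> 0"
      using s(1) by (metis lev_0)
    moreover have "l v = 0 \<longleftrightarrow> low (\<sigma> v) = Map.empty"
      using wf[OF s(1), unfolded wellformed_def] by iprover
    ultimately have "low (\<sigma> v) \<noteq> Map.empty"
      by simp
    then obtain u d where u: "low (\<sigma> v) u = Some d"
      by fastforce
    obtain m where m: "l v = Suc m" "lev K b m d" "lab d = u" "{u, lab (\<sigma> v)} \<in> K"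
      using low_facts[OF wf s(1) u] by metis
    have "{u} \<in> K"
      using verts[OF m(4)] by simp
    then have "l u = m"
      by (rule lev_l[OF m(2,3)])
    with m show "\<exists>u. {u, v} \<in> K \<and> Suc (l u) = l v"
      by (intro exI[of _ u]) (simp add: s(2))
  next
    fix v u u' assume u: "{u, v} \<in> K" "{u', v} \<in> K" "u \<noteq> u'" "Suc (l u) = l v" "Suc (l u') = l v"
    have s: "lev K b (l v) (\<sigma> v)" "lab (\<sigma> v) = v"
      using l\<sigma> verts[OF u(1)] by blast+
    have vu: "{v, u} \<in> K" "{v, u'} \<in> K" "u \<noteq> v" "u' \<noteq> v"
      using u by (auto simp: insert_commute)
    obtain d d' where "low (\<sigma> v) u = Some d" "low (\<sigma> v) u' = Some d'"
      using types[OF vu(1,3)] types[OF vu(2,4)] u(4,5) by auto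
    from low_tri(1)[OF wf s(1) this u(3)] show "tri K u u' v"
      by (simp add: s(2))
  next
    fix v x assume vx: "{v, x} \<in> K" "v \<noteq> x" "l v = l x"
    have s: "lev K b (l v) (\<sigma> v)" "lab (\<sigma> v) = v"
      using l\<sigma> verts[OF vx(1)] by blast+
    have "hor K (\<sigma> v) x"
      using types[of v x] vx by auto
    then obtain u d where u: "low (\<sigma> v) u = Some d" "tri K u v x"
      using s(2) by (auto elim: horE)
    obtain m where m: "l v = Suc m" "lev K b m d" "lab d = u" "{u, lab (\<sigma> v)} \<in> K"
      using low_facts[OF wf s(1) u(1)] by metis
    have "{u} \<in> K"
      using verts[OF m(4)] by simp
    then have "Suc (l u) = l v"
      using lev_l[OF m(2,3)] m(1) by simp
    with u(2) show "\<exists>u. tri K u v x \<and> Suc (l u) = l v"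
      by blast
  qed
qed

section \<open>Levels as graph distances\<close>

lemma walk_level_bound:
  assumes step: "\<And>x y. {x, y} \<in> edges G \<Longrightarrow> l y \<le> Suc (l x)"
  shows "successively (\<lambda>x y. {x, y} \<in> edges G) p \<Longrightarrow> p \<noteq> [] \<Longrightarrow>
    l (last p) \<le> l (hd p) + (length p - 1)"
proof (induction p rule: induct_list012)
  case (3 x y zs)
  then have "l (last (y # zs)) \<le> l y + length zs" "l y \<le> Suc (l x)"
    using step[of x y] by auto
  then show ?case
    by simp
qed auto

lemma graph_dist_eq_level:
  assumes step: "\<And>x y. {x, y} \<in> edges G \<Longrightarrow> l y \<le> Suc (l x)"
    and b: "b \<in> verts G" "l b = 0"
    and descend: "\<And>v. v \<in> verts G \<Longrightarrow> v \<noteq> b \<Longrightarrow>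
      \<exists>u. u \<in> verts G \<and> {u, v} \<in> edges G \<and> Suc (l u) = l v"
    and v: "v \<in> verts G"
  shows "graph_dist G b v = enat (l v)"
proof (rule antisym)
  have "\<exists>p. walk G p \<and> hd p = b \<and> last p = v \<and> length p = Suc (l v)"
    using v
  proof (induction "l v" arbitrary: v)
    case 0
    have "v = b"
    proof (rule ccontr)
      assume "v \<noteq> b"
      then show False
        using descend[OF 0(2)] 0(1) by auto
    qed
    then show ?case
      using b by (intro exI[of _ "[b]"]) (simp add: walk_def)
  next
    case (Suc n)
    then have "v \<noteq> b"
      using b(2) by auto
    then obtain u where u: "u \<in> verts G" "{u, v} \<in> edges G" "Suc (l u) = l v"
      using descend[OF Suc.prems] by blast
    then obtain p where "walk G p" "hd p = b" "last p = u" "length p = Suc (l u)"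
      using Suc.hyps(1)[of u] Suc.hyps(2) by auto
    then show ?case
      using u Suc.prems
      by (intro exI[of _ "p @ [v]"]) (auto simp: walk_def successively_append_iff)
  qed
  then obtain p where "walk G p" "hd p = b" "last p = v" "length p = Suc (l v)"
    by blast
  then show "graph_dist G b v \<le> enat (l v)"
    unfolding graph_dist_def by (intro INF_lower2[of p]) auto
  show "enat (l v) \<le> graph_dist G b v"
    unfolding graph_dist_def
  proof (rule INF_greatest)
    fix p assume "p \<in> {p. walk G p \<and> hd p = b \<and> last p = v}"
    then show "enat (l v) \<le> enat (length p - 1)"
      using walk_level_bound[where G = G and l = l and p = p, OF step] b(2)
      by (auto simp: walk_def)
  qed
qed

text \<open>All that is kept of the cover. From here on the level function is an abstract one, and
  \<open>G\<close> stands for the squaring graph, described by levels instead of distances.\<close>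

locale leveled_complex = large_girth_links K for K :: "'v set set" +
  fixes l :: "'v \<Rightarrow> nat" and b :: 'v and G :: "'v graph"
  assumes step: "\<And>v x. {v, x} \<in> K \<Longrightarrow> l x \<le> Suc (l v)"
    and descend: "\<And>v. {v} \<in> K \<Longrightarrow> v \<noteq> b \<Longrightarrow> \<exists>u. {u, v} \<in> K \<and> Suc (l u) = l v"
    and lower_pair: "\<And>v u u'. {u, v} \<in> K \<Longrightarrow> {u', v} \<in> K \<Longrightarrow> u \<noteq> u' \<Longrightarrow>
      Suc (l u) = l v \<Longrightarrow> Suc (l u') = l v \<Longrightarrow> tri K u u' v"
    and horizontal: "\<And>v x. {v, x} \<in> K \<Longrightarrow> v \<noteq> x \<Longrightarrow> l v = l x \<Longrightarrow>
      \<exists>u. tri K u v x \<and> Suc (l u) = l v"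
    and bK: "{b} \<in> K"
    and G_verts: "verts G = {v. {v} \<in> K}"
    and G_edges: "edges G = {{x, y} | x y. {x, y} \<in> K \<and> l x \<noteq> l y}"
begin

lemma edge_iff: "{x, y} \<in> edges G \<longleftrightarrow> {x, y} \<in> K \<and> l x \<noteq> l y"
  unfolding G_edges by (auto simp: doubleton_eq_iff insert_commute)

lemma edge_levels: "{x, y} \<in> edges G \<Longrightarrow> Suc (l x) = l y \<or> Suc (l y) = l x"
  using step[of x y] step[of y x] by (auto simp: edge_iff insert_commute)

lemma edge_in: "{x, y} \<in> edges G \<Longrightarrow> {x, y} \<in> K \<and> {y, x} \<in> K"
  by (simp add: edge_iff insert_commute)

text \<open>By \<open>lower_pair\<close> the three vertices are pairwise adjacent, and they form a
  3-cycle in the link of \<open>v\<close>.\<close>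

lemma three_lower:
  assumes "{x, v} \<in> K" "{y, v} \<in> K" "{z, v} \<in> K" "distinct [x, y, z]"
    "Suc (l x) = l v" "Suc (l y) = l v" "Suc (l z) = l v"
  shows False
proof -
  have "tri K x y v" "tri K y z v" "tri K z x v"
    using assms by (auto intro!: lower_pair)
  then show False
    using no3[of v x y z] by (simp add: tri_commute)
qed

definition diagonal :: "'v \<Rightarrow> 'v \<Rightarrow> 'v \<Rightarrow> 'v \<Rightarrow> bool" where
  "diagonal a c x y \<longleftrightarrow> l a = l c \<and> tri K x a c \<and> tri K y a c"

text \<open>The vertices \<open>x\<close> and \<open>y\<close> are adjacent because both lie
  directly below \<open>v\<close>. If \<open>u\<close> lies above them, the same reason applies to
  it. If \<open>u\<close> lies below, \<open>horizontal\<close> gives a common lower neighbour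
  \<open>u'\<close>, and \<open>u' \<noteq> u\<close> would make \<open>x\<close>, \<open>u\<close>,
  \<open>y\<close> a 3-cycle in the link of \<open>u'\<close>.\<close>

lemma diagonal_below_top:
  assumes "{v, x} \<in> edges G" "{v, y} \<in> edges G" "{u, x} \<in> edges G" "{u, y} \<in> edges G"
    "x \<noteq> y" "l x < l v" "l y < l v"
  shows "diagonal x y v u"
proof -
  have l: "Suc (l x) = l v" "Suc (l y) = l v"
    using edge_levels[OF assms(1)] edge_levels[OF assms(2)] assms(6,7) by auto
  have vxy: "tri K x y v"
    using edge_in[OF assms(1)] edge_in[OF assms(2)] assms(5) l by (intro lower_pair) simp_all
  have uK: "{u, x} \<in> K" "{u, y} \<in> K" "{x, u} \<in> K" "{y, u} \<in> K"
    using edge_in[OF assms(3)] edge_in[OF assms(4)] by simp_all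
  have "tri K u x y"
  proof (cases "Suc (l x) = l u")
    case True
    then have "tri K x y u"
      using uK assms(5) l by (intro lower_pair) simp_all
    then show ?thesis
      by (simp add: tri_commute)
  next
    case False
    then have u: "Suc (l u) = l x" "Suc (l u) = l y"
      using edge_levels[OF assms(3)] l by auto
    have "{x, y} \<in> K"
      using tri_edge[OF vxy] by simp
    then obtain u' where u': "tri K u' x y" "Suc (l u') = l x"
      using horizontal[of x y] assms(5) l by auto
    have "u' = u"
    proof (rule ccontr)
      assume "u' \<noteq> u"
      then have "tri K u' u x" "tri K u' u y"
        using tri_edge[OF u'(1)] u'(2) uK u by (auto intro!: lower_pair)
      then show False
        using no3[of u' x u y] u'(1) by (simp add: tri_commute)
    qed
    with u'(1) show ?thesis
      by simp
  qed
  then show ?thesis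
    using vxy l by (simp add: diagonal_def tri_commute)
qed

text \<open>Adjacent levels differ, so a vertex of greatest level lies above both of its neighbours
  in the cycle. It may be any of the four vertices, and \<open>diagonal_below_top\<close> applies to
  it.\<close>

lemma square_diagonal:
  assumes "{a, x} \<in> edges G" "{x, c} \<in> edges G" "{c, y} \<in> edges G" "{y, a} \<in> edges G"
    "a \<noteq> c" "x \<noteq> y"
  shows "diagonal a c x y \<or> diagonal x y a c"
proof -
  have e: "{x, a} \<in> edges G" "{c, x} \<in> edges G" "{y, c} \<in> edges G" "{a, y} \<in> edges G"
    using assms(1-4) by (simp_all add: insert_commute)
  have ne: "l a \<noteq> l x" "l x \<noteq> l c" "l c \<noteq> l y" "l y \<noteq> l a"
    using assms(1-4) by (simp_all add: edge_iff)
  have sym: "diagonal x y c a \<Longrightarrow> diagonal x y a c" "diagonal a c y x \<Longrightarrow> diagonal a c x y"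
    by (simp_all add: diagonal_def)
  consider "l x < l a" "l y < l a" | "l x < l c" "l y < l c" | "l a < l x" "l c < l x"
    | "l a < l y" "l c < l y"
    using ne by linarith
  then show ?thesis
  proof cases
    case 1
    then show ?thesis
      using diagonal_below_top[OF assms(1) e(4) e(2) assms(3)] assms(6) by simp
  next
    case 2
    then show ?thesis
      using diagonal_below_top[OF e(2) assms(3) assms(1) e(4)] assms(6) sym by simp
  next
    case 3
    then show ?thesis
      using diagonal_below_top[OF e(1) assms(2) assms(4) e(3)] assms(5) by simp
  next
    case 4
    then show ?thesis
      using diagonal_below_top[OF assms(4) e(3) e(1) assms(2)] assms(5) sym by simp
  qed
qed

text \<open>The hypotheses of the replacement rule (B) are contradictory in a squaring.\<close>

lemma no_three_squares:
  assumes "distinct [u, a0, a1, a2, b0, b1, b2]"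
    and e: "{u, a0} \<in> edges G" "{u, a1} \<in> edges G" "{u, a2} \<in> edges G"
      "{a0, b0} \<in> edges G" "{b0, a1} \<in> edges G" "{a1, b1} \<in> edges G" "{b1, a2} \<in> edges G"
      "{a2, b2} \<in> edges G" "{b2, a0} \<in> edges G"
  shows False
proof -
  have ne: "a0 \<noteq> a1" "a1 \<noteq> a2" "a2 \<noteq> a0" "u \<noteq> b0" "u \<noteq> b1" "u \<noteq> b2"
    using assms(1) by auto
  have ne': "a0 \<noteq> a2" "b0 \<noteq> a2" "b1 \<noteq> a0" "b2 \<noteq> a1"
    "b0 \<noteq> a1" "b1 \<noteq> a2" "b2 \<noteq> a0" "b0 \<noteq> a0" "b1 \<noteq> a1" "b2 \<noteq> a2"
    "b1 \<noteq> b0" "b2 \<noteq> b1" "b2 \<noteq> b0"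
    using assms(1) by auto
  \<comment> \<open>Each square contributes a path in the link of \<open>u\<close>: the edge between
    its two \<open>a\<close>'s if these form the diagonal, and otherwise a path of length 2 through
    its \<open>b\<close>.\<close>
  have d: "diagonal u b0 a0 a1 \<or> diagonal a0 a1 u b0"
    "diagonal u b1 a1 a2 \<or> diagonal a1 a2 u b1"
    "diagonal u b2 a2 a0 \<or> diagonal a2 a0 u b2"
    using square_diagonal[of u a0 b0 a1] square_diagonal[of u a1 b1 a2]
      square_diagonal[of u a2 b2 a0] e ne by (simp_all add: insert_commute)
  \<comment> \<open>If one of the three paths is a single edge, the closed cycle has length 3, 4 or
    5. The seven cases are the combinations other than three paths of length 2.\<close>
  have no_short: "diagonal u b0 a0 a1 \<and> diagonal u b1 a1 a2 \<and> diagonal u b2 a2 a0"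
  proof (rule ccontr)
    assume n: "\<not> ?thesis"
    consider "diagonal a0 a1 u b0" "diagonal a1 a2 u b1" "diagonal a2 a0 u b2"
      | "diagonal u b0 a0 a1" "diagonal a1 a2 u b1" "diagonal a2 a0 u b2"
      | "diagonal a0 a1 u b0" "diagonal u b1 a1 a2" "diagonal a2 a0 u b2"
      | "diagonal a0 a1 u b0" "diagonal a1 a2 u b1" "diagonal u b2 a2 a0"
      | "diagonal a0 a1 u b0" "diagonal u b1 a1 a2" "diagonal u b2 a2 a0"
      | "diagonal u b0 a0 a1" "diagonal a1 a2 u b1" "diagonal u b2 a2 a0"
      | "diagonal u b0 a0 a1" "diagonal u b1 a1 a2" "diagonal a2 a0 u b2"
      using d n by blast
    then show False
    proof cases
      case 1
      then show False
        using no3[of u a0 a1 a2] by (simp add: diagonal_def tri_commute)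
    next
      case 2
      then show False
        using no4[of u a0 b0 a1 a2] assms(1) ne ne' by (simp add: diagonal_def tri_commute)
    next
      case 3
      then show False
        using no4[of u a1 b1 a2 a0] assms(1) ne ne' by (simp add: diagonal_def tri_commute)
    next
      case 4
      then show False
        using no4[of u a2 b2 a0 a1] assms(1) ne ne' by (simp add: diagonal_def tri_commute)
    next
      case 5
      then show False
        using no5[of u a1 b1 a2 b2 a0] assms(1) ne ne' by (simp add: diagonal_def tri_commute)
    next
      case 6
      then show False
        using no5[of u a2 b2 a0 b0 a1] assms(1) ne ne' by (simp add: diagonal_def tri_commute)
    next
      case 7
      then show False
        using no5[of u a0 b0 a1 b1 a2] assms(1) ne ne' by (simp add: diagonal_def tri_commute)
    qed
  qed
  then have lb: "l b0 = l u" "l b1 = l u" "l b2 = l u"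
    by (simp_all add: diagonal_def)
  \<comment> \<open>Now all \<open>b\<close>'s are on the level of \<open>u\<close>. An
    \<open>a\<close> above \<open>u\<close> would have \<open>u\<close> and two of the
    \<open>b\<close>'s below it, so all three \<open>a\<close>'s lie below \<open>u\<close>, which
    is again too many.\<close>
  have lower: "Suc (l a) = l u"
    if a: "{u, a} \<in> edges G" "{a, x} \<in> edges G" "{y, a} \<in> edges G" "l x = l u" "l y = l u"
      "distinct [u, x, y]" for a x y
  proof (rule ccontr)
    assume "Suc (l a) \<noteq> l u"
    then have "Suc (l u) = l a"
      using edge_levels[OF a(1)] by simp
    then show False
      using three_lower[of u a x y] edge_in[OF a(1)] edge_in[OF a(2)] edge_in[OF a(3)] a(4-6)
      by simp
  qed
  have "Suc (l a0) = l u" "Suc (l a1) = l u" "Suc (l a2) = l u"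
    using lower[of a0 b0 b2] lower[of a1 b1 b0] lower[of a2 b2 b1] e lb ne ne' assms(1)
    by simp_all
  then show False
    using three_lower[of a0 u a1 a2] edge_in[OF e(1)] edge_in[OF e(2)] edge_in[OF e(3)] assms(1)
    by simp
qed

section \<open>The squaring as a quadric complex\<close>

definition X :: "'v square_cx" where
  "X = \<lparr>verts = verts G, edges = edges G, squares = four_cycles G\<rparr>"

lemma X_simps [simp]: "verts X = verts G" "edges X = edges G" "squares X = four_cycles G"
  by (simp_all add: X_def)

lemma bounds_square_edges:
  assumes "bounds_square X p q r s"
  shows "{p, q} \<in> edges G \<and> {q, r} \<in> edges G \<and> {r, s} \<in> edges G \<and> {s, p} \<in> edges G"
proof -
  have "cycle_edges [p, q, r, s] \<subseteq> edges G"
    using assms unfolding bounds_square_def X_simps by (rule four_cyclesE)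
  then show ?thesis
    by (simp add: cycle_edges_4)
qed

lemma edge_verts: "{x, y} \<in> edges G \<Longrightarrow> x \<in> verts G \<and> y \<in> verts G"
  using face[of "{x, y}" "{x}"] face[of "{x, y}" "{y}"] by (simp add: edge_iff G_verts)

lemma bounds_squareI:
  assumes "distinct [p, q, r, s]"
    "{p, q} \<in> edges G" "{q, r} \<in> edges G" "{r, s} \<in> edges G" "{s, p} \<in> edges G"
  shows "bounds_square X p q r s"
  using assms edge_verts unfolding bounds_square_def X_simps
  by (intro cycle_edges_4_in_four_cycles) simp_all

lemma four_cycles_X: "four_cycles X = four_cycles G"
  by (simp add: four_cycles_def embedded_cycle_def)

lemma square_complex_X: "square_complex X"
proof -
  have "e \<subseteq> verts G \<and> card e = 2" if e: "e \<in> edges G" for e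
  proof -
    obtain x y where "e = {x, y}" "l x \<noteq> l y"
      using e unfolding G_edges by blast
    moreover from this have "x \<noteq> y"
      by blast
    ultimately show ?thesis
      using e edge_verts by simp
  qed
  then show ?thesis
    by (simp add: square_complex_def simplicial_graph_def four_cycles_X)
qed

theorem quadric_complex_X: "quadric_complex X"
  unfolding quadric_complex_def
proof (intro conjI square_complex_X)
  interpret square_cx X
    by (rule square_cx.intro[OF square_complex_X])
  show "simply_connected_top (square_realization X)"
  proof (rule simply_connected_square_realization[of l b])
    show "l x \<noteq> l y" if "{x, y} \<in> edges X" for x y
      using that by (simp add: edge_iff)
    show "b \<in> verts X"
      using bK by (simp add: G_verts)
    show "\<exists>y. {v, y} \<in> edges X \<and> l y < l v" if "v \<in> verts X" "v \<noteq> b" for v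
    proof -
      obtain u where u: "{u, v} \<in> K" "Suc (l u) = l v"
        using descend[of v] \<open>v \<in> verts X\<close> \<open>v \<noteq> b\<close> by (auto simp: G_verts)
      then have "{v, u} \<in> edges X" "l u < l v"
        by (simp_all add: edge_iff insert_commute)
      then show ?thesis
        by blast
    qed
    fix v x y
    assume a: "{v, x} \<in> edges X" "{v, y} \<in> edges X" "l x < l v" "l y < l v" "x \<noteq> y"
    then have vx: "{v, x} \<in> edges G" and vy: "{v, y} \<in> edges G"
      by simp_all
    have lv: "Suc (l x) = l v" "Suc (l y) = l v"
      using edge_levels[OF vx] edge_levels[OF vy] a(3,4) by auto
    have "tri K x y v"
      using edge_in[OF vx] edge_in[OF vy] a(5) lv by (intro lower_pair) simp_all
    \<comment> \<open>The two lower neighbours of \<open>v\<close> span a horizontal edge; its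
      common lower neighbour, two levels below \<open>v\<close>, is the fourth corner of the
      square.\<close>
    then obtain u where u: "tri K u x y" "Suc (l u) = l x"
      using horizontal[of x y] tri_edge a(5) lv by fastforce
    have "bounds_square X v x u y"
    proof (rule bounds_squareI)
      show "{x, u} \<in> edges G" "{u, y} \<in> edges G"
        using tri_edge[OF u(1)] u(2) lv by (auto simp: edge_iff insert_commute)
      show "distinct [v, x, u, y]"
        using a(5) u(2) lv by auto
    qed (use vx vy in \<open>simp_all add: insert_commute\<close>)
    moreover have "l u < l v"
      using u(2) lv by simp
    ultimately show "\<exists>u. l u < l v \<and> cycle_edges [v, x, u, y] \<in> squares X"
      unfolding bounds_square_def by blast
  qed
next
  show "replacement_A X"
    unfolding replacement_A_def
  proof (intro allI impI, elim conjE)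
    fix u0 u1 v0 v1 v2
    assume d: "distinct [u0, u1, v0, v1, v2]" and s: "bounds_square X u0 v0 u1 v1"
      "bounds_square X u0 v1 u1 v2"
    show "bounds_square X u0 v0 u1 v2"
      using d bounds_square_edges[OF s(1)] bounds_square_edges[OF s(2)]
      by (intro bounds_squareI) auto
  qed
next
  show "replacement_B X"
    unfolding replacement_B_def
  proof (intro allI impI, elim conjE)
    fix u a0 a1 a2 b0 b1 b2
    assume d: "distinct [u, a0, a1, a2, b0, b1, b2]" and s: "bounds_square X u a0 b0 a1"
      "bounds_square X u a1 b1 a2" "bounds_square X u a2 b2 a0"
    have False
      using no_three_squares[OF d] s[THEN bounds_square_edges] by simp
    then show "{b2, a1} \<in> edges X \<and> bounds_square X b2 a0 b0 a1 \<and> bounds_square X a1 b1 a2 b2 \<or>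
      {a0, b1} \<in> edges X \<and> bounds_square X a0 b0 a1 b1 \<and> bounds_square X b1 a2 b2 a0 \<or>
      {a2, b0} \<in> edges X \<and> bounds_square X b0 a1 b1 a2 \<and> bounds_square X a2 b2 a0 b0" ..
  qed
qed

end

theorem theorem3p2:
  fixes Y :: "'v set set" and b :: 'v
  assumes "systolic_2cx Y"
    and "b \<in> verts (one_skeleton Y)"
  shows "quadric_complex (squaring Y b)"
proof -
  interpret large_girth_links Y
    using assms(1) by (rule systolic_large_girth_links)
  have vertex: "{v} \<in> Y \<longleftrightarrow> v \<in> \<Union>Y" for v
    using face[of _ "{v}"] by auto
  have b: "{b} \<in> Y"
    using assms(2) by (simp add: vertex one_skeleton_def)
  have sc: "simply_connected_top (realization Y)"
    using assms(1) by (simp add: systolic_2cx_def)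
  obtain l :: "'v \<Rightarrow> nat" where l: "l b = 0"
    "\<And>v x. {v, x} \<in> Y \<Longrightarrow> l x \<le> Suc (l v)"
    "\<And>v. {v} \<in> Y \<Longrightarrow> v \<noteq> b \<Longrightarrow> \<exists>u. {u, v} \<in> Y \<and> Suc (l u) = l v"
    "\<And>v u u'. {u, v} \<in> Y \<Longrightarrow> {u', v} \<in> Y \<Longrightarrow> u \<noteq> u' \<Longrightarrow> Suc (l u) = l v \<Longrightarrow> Suc (l u') = l v \<Longrightarrow>
       tri Y u u' v"
    "\<And>v x. {v, x} \<in> Y \<Longrightarrow> v \<noteq> x \<Longrightarrow> l v = l x \<Longrightarrow> \<exists>u. tri Y u v x \<and> Suc (l u) = l v"
    by (rule ex_level_function[OF sc b]) (rule that; assumption)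
  let ?G = "one_skeleton Y"
  have edge: "{x, y} \<in> edges ?G \<longleftrightarrow> {x, y} \<in> Y \<and> x \<noteq> y" for x y
    by (auto simp: one_skeleton_def)
  have dist: "graph_dist ?G b v = enat (l v)" if "v \<in> verts ?G" for v
  proof (rule graph_dist_eq_level[where G = ?G and l = l and b = b, OF _ assms(2) l(1) _ that])
    show "l y \<le> Suc (l x)" if "{x, y} \<in> edges ?G" for x y
      using that l(2)[of x y] by (simp add: edge)
    fix v assume v: "v \<in> verts ?G" "v \<noteq> b"
    then obtain u where u: "{u, v} \<in> Y" "Suc (l u) = l v"
      using l(3)[of v] by (auto simp: one_skeleton_def vertex)
    moreover have "u \<in> verts ?G"
      using u(1) by (auto simp: one_skeleton_def)
    moreover have "u \<noteq> v"
      using u(2) by auto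
    ultimately show "\<exists>u. u \<in> verts ?G \<and> {u, v} \<in> edges ?G \<and> Suc (l u) = l v"
      by (auto simp: edge)
  qed
  have in_verts: "x \<in> verts ?G \<and> y \<in> verts ?G" if "{x, y} \<in> Y" for x y
    using that by (auto simp: one_skeleton_def)
  have V: "verts (squaring_graph Y b) = {v. {v} \<in> Y}"
    by (auto simp: squaring_graph_def one_skeleton_def vertex)
  \<comment> \<open>The distances in the definition of the squaring are exchanged for levels, which
    brings the graph into the form required by \<open>leveled_complex\<close>.\<close>
  have "{x, y} \<in> edges ?G \<and> graph_dist ?G b x \<noteq> graph_dist ?G b y \<longleftrightarrow>
      {x, y} \<in> Y \<and> l x \<noteq> l y" for x y
    using in_verts[of x y] dist by (auto simp: edge)
  then have E: "edges (squaring_graph Y b) = {{x, y} | x y. {x, y} \<in> Y \<and> l x \<noteq> l y}"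
    by (simp add: squaring_graph_def)
  interpret leveled_complex Y l b "squaring_graph Y b"
    by unfold_locales (fact l(2), fact l(3), fact l(4), fact l(5), fact b, fact V, fact E)
  have "squaring Y b = X"
    by (simp add: squaring_def X_def)
  then show ?thesis
    using quadric_complex_X by simp
qed

end
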